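(* Let $k$ and $m$ be positive integers and let $\lambda/\mu$ be a border strip. If $\lambda_i-\mu_i$ is divisible by $m$ for all $i\ge 1$, then there exists an action of a cyclic group $C_m$ of order $m$ on the set $\mathrm{SSYT}_{k}(\lambda/\mu)$ such that the triple $$\left(\mathrm{SSYT}_{k}(\lambda/\mu),\ C_m,\ s_{\lambda/\mu}(1,q,\ldots,q^{k-1})\right)$$ exhibits the cyclic sieving phenomenon.
   Context: A partition $\lambda=(\lambda_1,\lambda_2,\ldots)$ is a weakly decreasing sequence of nonnegative integers with finitely many nonzero terms, identified with its Young diagram. A skew partition (skew shape) $\lambda/\mu$ is a pair of partitions $(\lambda,\mu)$ with $\lambda_i\ge\mu_i$ for all $i$. A border strip is a connected skew shape (connected via squares sharing an edge) containing no $2\times 2$ square. For a positive integer $k$, $\mathrm{SSYT}_k(\lambda/\mu)$ is the set of semistandard Young tableaux of skew shape $\lambda/\mu$ with entries in $\{1,\ldots,k\}$ (rows weakly increasing, columns strictly increasing), and $s_{\lambda/\mu}(x_1,\ldots,x_k)=\sum_{T\in \mathrm{SSYT}_k(\lambda/\mu)}\prod_{i=1}^k x_i^{\#\{i\text{'s in }T\}}$ is the skew Schur polynomial; $s_{\lambda/\mu}(1,q,\ldots,q^{k-1})$ is its principal specialization $x_i=q^{i-1}$. Cyclic sieving phenomenon: let $X$ be a finite set on which a finite cyclic group $C$ acts and let $X(q)$ be a polynomial in $q$ with nonnegative integer coefficients. For $d\in\mathbb{Z}_{>0}$ let $\omega_d$ be a primitive $d$th root of unity. The triple $(X,C,X(q))$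 exhibits the cyclic sieving phenomenon if $\#X^c=X(\omega_{\mathrm{o}(c)})$ for all $c\in C$, where $X^c$ is the set of points of $X$ fixed by $c$ and $\mathrm{o}(c)$ is the order of $c$ in $C$. *)

theory Defs
  imports
    "HOL-Computational_Algebra.Polynomial"
    "HOL-Library.FuncSet"
    "HOL-Algebra.Elementary_Groups"
    "HOL-Algebra.Multiplicative_Group"
    "HOL-Algebra.Group_Action"
    Complex_Main
begin

text \<open>Parts, rows and columns are indexed from 0: \<open>lam i\<close> is the part usually written
  with index \<open>i + 1\<close>.\<close>

definition is_partition :: "(nat \<Rightarrow> nat) \<Rightarrow> bool" where
  "is_partition lam \<longleftrightarrow> antimono lam \<and> finite {i. lam i \<noteq> 0}"

definition skew_partition :: "(nat \<Rightarrow> nat) \<Rightarrow> (nat \<Rightarrow> nat) \<Rightarrow> bool" where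
  "skew_partition lam mu \<longleftrightarrow>
     is_partition lam \<and> is_partition mu \<and> (\<forall>i. mu i \<le> lam i)"

definition skew_diagram :: "(nat \<Rightarrow> nat) \<Rightarrow> (nat \<Rightarrow> nat) \<Rightarrow> (nat \<times> nat) set" where
  "skew_diagram lam mu = {(i, j). mu i \<le> j \<and> j < lam i}"

definition adjacent_cells :: "nat \<times> nat \<Rightarrow> nat \<times> nat \<Rightarrow> bool" where
  "adjacent_cells c d \<longleftrightarrow>
     (fst c = fst d \<and> (snd d = Suc (snd c) \<or> snd c = Suc (snd d))) \<or>
     (snd c = snd d \<and> (fst d = Suc (fst c) \<or> fst c = Suc (fst d)))"

definition connected_cells :: "(nat \<times> nat) set \<Rightarrow> bool" where
  "connected_cells D \<longleftrightarrow>
     (\<forall>c\<in>D. \<forall>d\<in>D. (c, d) \<in> {(a, b). a \<in> D \<and> b \<in> D \<and> adjacent_cells a b}\<^sup>*)"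

text \<open>The empty skew shape counts as connected here, hence as a border strip.\<close>

definition border_strip :: "(nat \<Rightarrow> nat) \<Rightarrow> (nat \<Rightarrow> nat) \<Rightarrow> bool" where
  "border_strip lam mu \<longleftrightarrow>
     skew_partition lam mu \<and>
     connected_cells (skew_diagram lam mu) \<and>
     (\<nexists>i j. {(i, j), (i, Suc j), (Suc i, j), (Suc i, Suc j)} \<subseteq> skew_diagram lam mu)"

text \<open>Tableaux are extensional functions on the diagram, so that distinct elements of
  \<open>SSYT k lam mu\<close> are distinct fillings.\<close>

definition SSYT :: "nat \<Rightarrow> (nat \<Rightarrow> nat) \<Rightarrow> (nat \<Rightarrow> nat) \<Rightarrow> (nat \<times> nat \<Rightarrow> nat) set" where
  "SSYT k lam mu =
     {T \<in> skew_diagram lam mu \<rightarrow>\<^sub>E {1..k}.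
        (\<forall>i j j'. (i, j) \<in> skew_diagram lam mu \<longrightarrow> (i, j') \<in> skew_diagram lam mu \<longrightarrow>
           j < j' \<longrightarrow> T (i, j) \<le> T (i, j')) \<and>
        (\<forall>i i' j. (i, j) \<in> skew_diagram lam mu \<longrightarrow> (i', j) \<in> skew_diagram lam mu \<longrightarrow>
           i < i' \<longrightarrow> T (i, j) < T (i', j))}"

text \<open>The skew Schur polynomial in \<open>k\<close> variables, as a polynomial function of
  \<open>x 1, \<dots>, x k\<close> with values in an arbitrary commutative semiring.\<close>

definition skew_schur ::
    "nat \<Rightarrow> (nat \<Rightarrow> nat) \<Rightarrow> (nat \<Rightarrow> nat) \<Rightarrow> (nat \<Rightarrow> 'a) \<Rightarrow> 'a::comm_semiring_1" where
  "skew_schur k lam mu x =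
     (\<Sum>T\<in>SSYT k lam mu. \<Prod>i=1..k. x i ^ card {c \<in> skew_diagram lam mu. T c = i})"

text \<open>The variable \<open>q\<close> is the polynomial \<open>[:0, 1:]\<close>.\<close>

definition principal_specialization ::
    "nat \<Rightarrow> (nat \<Rightarrow> nat) \<Rightarrow> (nat \<Rightarrow> nat) \<Rightarrow> int poly" where
  "principal_specialization k lam mu = skew_schur k lam mu (\<lambda>i. [:0, 1:] ^ (i - 1))"

definition primitive_root_of_unity :: "nat \<Rightarrow> complex \<Rightarrow> bool" where
  "primitive_root_of_unity d w \<longleftrightarrow>
     0 < d \<and> w ^ d = 1 \<and> (\<forall>j. 0 < j \<and> j < d \<longrightarrow> w ^ j \<noteq> 1)"

text \<open>The action of \<open>C\<close> on \<open>X\<close> is the homomorphism \<open>act\<close> into the group of bijections of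
  \<open>X\<close>. The evaluation condition is required for every choice of a primitive root of unity.\<close>

definition cyclic_sieving ::
    "'x set \<Rightarrow> 'c monoid \<Rightarrow> ('c \<Rightarrow> 'x \<Rightarrow> 'x) \<Rightarrow> int poly \<Rightarrow> bool" where
  "cyclic_sieving X C act p \<longleftrightarrow>
     finite X \<and> finite (carrier C) \<and> cyclic_group C \<and> group_action C X act \<and>
     (\<forall>n. 0 \<le> Polynomial.coeff p n) \<and>
     (\<forall>c\<in>carrier C. \<forall>w. primitive_root_of_unity (group.ord C c) w \<longrightarrow>
        of_nat (card {x \<in> X. act c x = x}) = poly (map_poly of_int p) w)"

end

theory Submission
  imports Defs "HOL-Computational_Algebra.Polynomial_FPS"
begin

text \<open>
  Reading the cells of a border strip from its lower left end to its upper right end, and lowering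
  every entry by 1, turns semistandard tableaux into words over \<open>{0..<k}\<close> whose descents
  occur exactly at the places where a new row begins. The principal specialization becomes the
  generating function of the letter sum. When all row lengths are multiples of \<open>m\<close>, so are all
  descent positions and the length of the word.

  Let \<open>d\<close> divide \<open>m\<close> and let \<open>z\<close> be a primitive \<open>d\<close>-th root of unity. Call a word \<open>d\<close>-dilated if
  its letters are multiples of \<open>d\<close> and it is constant on each block of \<open>d\<close> consecutive positions.
  The value of the generating function at \<open>z\<close> is the number of \<open>d\<close>-dilated words
  (\<open>sum_root_of_unity_descent_words\<close>). Indeed, \<open>w \<mapsto> z ^ sum_list w\<close> and the
  indicator function of the \<open>d\<close>-dilated words are both multiplicative under concatenation behind a
  word whose length is a multiple of \<open>d\<close>. Cutting words at their first descent therefore expresses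
  both totals, by the same formula, through totals over weakly increasing words. For the latter,
  which are values of complete homogeneous symmetric polynomials, both totals satisfy the
  recurrence \<open>h k (n + d) = h (k - d) (n + d) + h k n\<close> for \<open>k > 0\<close>: on the side of \<open>z\<close> it comes from the
  factorization of \<open>1 - X ^ d\<close>, on the other side from removing a last block that consists of the
  largest available letter.

  A word is \<open>d\<close>-dilated if and only if \<open>d\<close> divides a certain number \<open>e w\<close>, namely the greatest
  common divisor of \<open>m\<close>, the letters, and the positions where the letter changes. So the values of
  the polynomial are the fixed point counts of a cyclic action in which \<open>w\<close> has a stabilizer
  of order \<open>e w\<close>, provided that such an action exists. Its orbits would have length
  \<open>m div e w\<close>, so the only obstruction is that \<open>m div i\<close> must divide the number of words with
  \<open>e w = i\<close>. Averaging the values at all \<open>m\<close>-th roots of unity shows that the sum of \<open>e w\<close> over the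
  words with \<open>e w dvd i\<close> equals \<open>m\<close> times the number of words with letter sum congruent to
  \<open>i\<close> modulo \<open>m\<close> (\<open>level_set_weight_dvd\<close>), and induction on \<open>i\<close> yields the divisibility
  (\<open>card_level_set_dvd\<close>). The action then rotates each level set of \<open>e\<close> in cycles of the right
  length (\<open>ex_cyclic_action\<close>).
\<close>

section \<open>Words with prescribed descents\<close>

definition descent_words :: "nat \<Rightarrow> nat \<Rightarrow> nat set \<Rightarrow> nat list set" where
  "descent_words k n S =
     {w. length w = n \<and> set w \<subseteq> {..<k} \<and>
         (\<forall>p. Suc p < n \<longrightarrow> (w ! Suc p < w ! p \<longleftrightarrow> Suc p \<in> S))}"

text \<open>The words that arise from a word of length \<open>length w div d\<close> by multiplying each letter by
  \<open>d\<close> and repeating it \<open>d\<close> times, at least when \<open>d\<close> divides \<open>length w\<close>. The condition on blocks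
  is phrased through the positions \<open>Suc p\<close> at which the letter changes, so that all conditions
  have the form that \<open>d\<close> divides something.\<close>

definition dilated :: "nat \<Rightarrow> nat list \<Rightarrow> bool" where
  "dilated d w \<longleftrightarrow>
     (\<forall>x\<in>set w. d dvd x) \<and>
     (\<forall>p. Suc p < length w \<longrightarrow> w ! p \<noteq> w ! Suc p \<longrightarrow> d dvd Suc p)"

text \<open>The largest divisor \<open>d\<close> of \<open>m\<close> for which the word is \<open>d\<close>-dilated; in the action to be
  constructed it is the order of the stabilizer.\<close>

definition dilation_index :: "nat \<Rightarrow> nat list \<Rightarrow> nat" where
  "dilation_index m w =
     Gcd (insert m (set w \<union> {Suc p | p. Suc p < length w \<and> w ! p \<noteq> w ! Suc p}))"

lemma dvd_dilation_index_iff: "d dvd dilation_index m w \<longleftrightarrow> d dvd m \<and> dilated d w"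
  unfolding dilation_index_def dvd_Gcd_iff dilated_def by blast

lemma finite_descent_words [simp]: "finite (descent_words k n S)"
  by (rule finite_subset [OF _ finite_lists_length_eq [of "{..<k}" n]])
     (auto simp: descent_words_def)

lemma descent_words_append_iff:
  assumes "0 < length u" "length u + length v = n" "length u \<in> S"
    and "\<And>i. i < length u \<Longrightarrow> 0 < i \<Longrightarrow> i \<notin> S"
  shows "u @ v \<in> descent_words k n S \<union> descent_words k n (S - {length u}) \<longleftrightarrow>
         u \<in> descent_words k (length u) {} \<and>
         v \<in> descent_words k (length v) {i. 0 < i \<and> length u + i \<in> S}"
    (is "?L \<longleftrightarrow> ?R")
proof -
  have "?L \<longleftrightarrow> set u \<subseteq> {..<k} \<and> set v \<subseteq> {..<k} \<and>
      (\<forall>p. Suc p < n \<longrightarrow> Suc p \<noteq> length u \<longrightarrow>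
          ((u @ v) ! Suc p < (u @ v) ! p \<longleftrightarrow> Suc p \<in> S))"
  proof -
    obtain q where q: "length u = Suc q" using assms(1) by (cases "length u") auto
    have "(\<forall>p. Suc p < n \<longrightarrow> (D p \<longleftrightarrow> Suc p \<in> S)) \<or>
          (\<forall>p. Suc p < n \<longrightarrow> (D p \<longleftrightarrow> Suc p \<in> S - {length u})) \<longleftrightarrow>
          (\<forall>p. Suc p < n \<longrightarrow> Suc p \<noteq> length u \<longrightarrow> (D p \<longleftrightarrow> Suc p \<in> S))" (is "?X \<or> ?Y \<longleftrightarrow> ?Z")
      for D :: "nat \<Rightarrow> bool"
    proof
      assume Z: ?Z
      show "?X \<or> ?Y"
      proof (cases "D q")
        case True
        then have ?X using Z q assms(3) by (metis old.nat.inject)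
        then show ?thesis ..
      next
        case False
        then have ?Y using Z q by (metis Diff_iff old.nat.inject singletonD singletonI)
        then show ?thesis ..
      qed
    qed blast
    note rest = this[of "\<lambda>p. (u @ v) ! Suc p < (u @ v) ! p"]
    show ?thesis
      unfolding rest [symmetric] descent_words_def Un_iff mem_Collect_eq
      by (simp only: length_append set_append Un_subset_iff assms(2)) blast
  qed
  also have "(\<forall>p. Suc p < n \<longrightarrow> Suc p \<noteq> length u \<longrightarrow>
          ((u @ v) ! Suc p < (u @ v) ! p \<longleftrightarrow> Suc p \<in> S)) \<longleftrightarrow>
        (\<forall>p. Suc p < length u \<longrightarrow> \<not> u ! Suc p < u ! p) \<and>
        (\<forall>p. Suc p < length v \<longrightarrow> (v ! Suc p < v ! p \<longleftrightarrow> length u + Suc p \<in> S))"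
    (is "?A \<longleftrightarrow> ?B \<and> ?C")
  proof (intro iffI conjI)
    assume A: ?A
    show ?B
    proof (intro allI impI)
      fix p assume p: "Suc p < length u"
      then have "(u @ v) ! Suc p < (u @ v) ! p \<longleftrightarrow> Suc p \<in> S"
        using A assms(2) by auto
      then show "\<not> u ! Suc p < u ! p"
        using p assms(4)[of "Suc p"] by (auto simp: nth_append)
    qed
    show ?C
    proof (intro allI impI)
      fix p assume p: "Suc p < length v"
      then show "v ! Suc p < v ! p \<longleftrightarrow> length u + Suc p \<in> S"
        using A[rule_format, of "length u + p"] assms(2) nth_append_length_plus[of u v "Suc p"]
        by simp
    qed
  next
    assume BC: "?B \<and> ?C"
    show ?A
    proof (intro allI impI)
      fix p assume p: "Suc p < n" "Suc p \<noteq> length u"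
      show "(u @ v) ! Suc p < (u @ v) ! p \<longleftrightarrow> Suc p \<in> S"
      proof (cases "Suc p < length u")
        case True
        then show ?thesis using BC assms(4)[of "Suc p"] by (auto simp: nth_append)
      next
        case False
        then have "p = length u + (p - length u)" "Suc (p - length u) < length v"
          using p assms(2) by auto
        then obtain r where "p = length u + r" "Suc r < length v" by blast
        then show ?thesis using BC by (simp add: nth_append)
      qed
    qed
  qed
  finally show ?thesis by (auto simp: descent_words_def)
qed

text \<open>The product of ribbon Schur functions in terms of words: gluing an increasing word of length
  \<open>p\<close> in front of another word may or may not create a descent at \<open>p\<close>. It lets sums over words with
  more descents be computed from sums over words with fewer.\<close>

lemma sum_descent_words_split:
  fixes f :: "nat list \<Rightarrow> 'a::comm_ring_1"
  assumes p: "0 < p" "p < n" "p \<in> S" "\<And>i. i < p \<Longrightarrow> 0 < i \<Longrightarrow> i \<notin> S"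
    and f: "\<And>u v. length u = p \<Longrightarrow> f (u @ v) = f u * f v"
  shows "(\<Sum>w\<in>descent_words k n S. f w) + (\<Sum>w\<in>descent_words k n (S - {p}). f w) =
         (\<Sum>w\<in>descent_words k p {}. f w) *
         (\<Sum>w\<in>descent_words k (n - p) {i. 0 < i \<and> p + i \<in> S}. f w)"
proof -
  let ?V = "descent_words k (n - p) {i. 0 < i \<and> p + i \<in> S}"
  have iff: "u @ v \<in> descent_words k n S \<union> descent_words k n (S - {p}) \<longleftrightarrow>
      u \<in> descent_words k p {} \<and> v \<in> ?V"
    if "length u = p" "length v = n - p" for u v
    using descent_words_append_iff[of u v n S k] that p by simp
  have len: "length w = n" if "w \<in> descent_words k n T" for w n T
    using that by (simp add: descent_words_def)
  have disj: "descent_words k n S \<inter> descent_words k n (S - {p}) = {}"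
  proof -
    have "w \<notin> descent_words k n (S - {p})" if "w \<in> descent_words k n S" for w
      using that p(1-3) unfolding descent_words_def
      by simp (metis Suc_pred)
    then show ?thesis by blast
  qed
  have "(\<Sum>w\<in>descent_words k p {}. f w) * (\<Sum>w\<in>?V. f w) =
      (\<Sum>(u, v)\<in>descent_words k p {} \<times> ?V. f u * f v)"
    by (simp add: sum_product sum.cartesian_product)
  also have "\<dots> = (\<Sum>w\<in>descent_words k n S \<union> descent_words k n (S - {p}). f w)"
  proof (rule sum.reindex_bij_witness[where j = "\<lambda>(u, v). u @ v" and
        i = "\<lambda>w. (take p w, drop p w)"])
    fix w assume w: "w \<in> descent_words k n S \<union> descent_words k n (S - {p})"
    then have "length w = n" using len by blast
    then show "(take p w, drop p w) \<in> descent_words k p {} \<times> ?V"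
      using w iff[of "take p w" "drop p w"] p(2) by simp
  next
    fix uv assume "uv \<in> descent_words k p {} \<times> ?V"
    then obtain u v where uv: "uv = (u, v)" "u \<in> descent_words k p {}" "v \<in> ?V" by blast
    then have l: "length u = p" "length v = n - p" by (auto dest: len)
    show "(\<lambda>w. (take p w, drop p w)) ((\<lambda>(u, v). u @ v) uv) = uv" using uv(1) l by simp
    show "(\<lambda>(u, v). u @ v) uv \<in> descent_words k n S \<union> descent_words k n (S - {p})"
      using iff[OF l] uv by (simp del: Un_iff)
    show "f ((\<lambda>(u, v). u @ v) uv) = (\<lambda>(u, v). f u * f v) uv" using uv(1) f[OF l(1)] by simp
  qed simp
  also have "\<dots> = (\<Sum>w\<in>descent_words k n S. f w) + (\<Sum>w\<in>descent_words k n (S - {p}). f w)"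
    by (rule sum.union_disjoint) (use disj in auto)
  finally show ?thesis by simp
qed

text \<open>Solving the previous identity for the sum over \<open>S\<close>, with \<open>p\<close> the smallest descent, determines
  it from sums with fewer descents. Hence two weights that are multiplicative at the cutting
  positions, and agree in total on weakly increasing words, agree in total everywhere.\<close>

lemma sum_descent_words_cong:
  fixes f g :: "nat list \<Rightarrow> 'a::comm_ring_1"
  assumes mult: "\<And>u v. d dvd length u \<Longrightarrow> f (u @ v) = f u * f v"
      "\<And>u v. d dvd length u \<Longrightarrow> g (u @ v) = g u * g v"
    and base: "\<And>n. d dvd n \<Longrightarrow>
      (\<Sum>w\<in>descent_words k n {}. f w) = (\<Sum>w\<in>descent_words k n {}. g w)"
    and S: "d dvd n" "S \<subseteq> {0<..<n}" "\<And>s. s \<in> S \<Longrightarrow> d dvd s"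
  shows "(\<Sum>w\<in>descent_words k n S. f w) = (\<Sum>w\<in>descent_words k n S. g w)"
  using S
proof (induction "card S" arbitrary: n S rule: less_induct)
  case less
  show ?case
  proof (cases "S = {}")
    case True
    then show ?thesis using base less.prems by simp
  next
    case False
    have fin: "finite S" using less.prems(2) finite_subset by blast
    define p where "p = Min S"
    have pS: "p \<in> S" using False fin by (simp add: p_def)
    have small: "i \<notin> S" if "i < p" for i
      using that fin by (auto simp: p_def dest: Min_le)
    have p: "0 < p" "p < n" "d dvd p" using pS less.prems by auto
    define T where "T = {i. 0 < i \<and> p + i \<in> S}"
    have "(+) p ` T \<subseteq> S - {p}" by (auto simp: T_def)
    then have "card ((+) p ` T) \<le> card (S - {p})" using fin by (intro card_mono) auto
    also have lt: "card (S - {p}) < card S" using pS fin by (intro card_Diff1_less)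
    finally have cT: "card T < card S" by (simp add: card_image)
    have T: "T \<subseteq> {0<..<n - p}" "\<And>s. s \<in> T \<Longrightarrow> d dvd s"
    proof -
      have "p + s \<in> S \<Longrightarrow> p + s < n" for s using less.prems(2) by auto
      then show "T \<subseteq> {0<..<n - p}" by (fastforce simp: T_def)
      show "d dvd s" if "s \<in> T" for s
        using that less.prems(3)[of "p + s"] p(3) by (simp add: T_def dvd_add_right_iff)
    qed
    have "(\<Sum>w\<in>descent_words k n S. f w) + (\<Sum>w\<in>descent_words k n (S - {p}). f w) =
         (\<Sum>w\<in>descent_words k p {}. f w) * (\<Sum>w\<in>descent_words k (n - p) T. f w)"
      unfolding T_def using p pS small by (intro sum_descent_words_split) (auto intro: mult)
    also have "\<dots> = (\<Sum>w\<in>descent_words k p {}. g w) * (\<Sum>w\<in>descent_words k (n - p) T. g w)"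
      using base[OF p(3)] less.hyps[OF cT _ T] less.prems(1) p(3) by simp
    also have "\<dots> = (\<Sum>w\<in>descent_words k n S. g w) + (\<Sum>w\<in>descent_words k n (S - {p}). g w)"
      unfolding T_def using p pS small
      by (intro sum_descent_words_split [symmetric]) (auto intro: mult)
    also have "(\<Sum>w\<in>descent_words k n (S - {p}). g w) = (\<Sum>w\<in>descent_words k n (S - {p}). f w)"
      using less.prems by (intro less.hyps [symmetric] lt) auto
    finally show ?thesis by simp
  qed
qed

text \<open>The position at which the two words meet is a multiple of \<open>d\<close>, where the letter is free to
  change.\<close>

lemma dilated_append:
  assumes "d dvd length u"
  shows "dilated d (u @ v) \<longleftrightarrow> dilated d u \<and> dilated d v"
proof
  assume uv: "dilated d (u @ v)"
  have "d dvd Suc p" if "Suc p < length v" "v ! p \<noteq> v ! Suc p" for p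
  proof -
    have "d dvd Suc (length u + p)"
      using uv that unfolding dilated_def by (auto simp: nth_append)
    then show ?thesis using assms by (metis add_Suc_right dvd_add_right_iff)
  qed
  moreover have "d dvd Suc p" if "Suc p < length u" "u ! p \<noteq> u ! Suc p" for p
    using uv that unfolding dilated_def by (auto simp: nth_append)
  ultimately show "dilated d u \<and> dilated d v"
    using uv by (auto simp: dilated_def)
next
  assume uv: "dilated d u \<and> dilated d v"
  have "d dvd Suc p" if p: "Suc p < length u + length v" "(u @ v) ! p \<noteq> (u @ v) ! Suc p" for p
  proof (cases "Suc p" "length u" rule: linorder_cases)
    case less
    then show ?thesis using uv p by (auto simp: dilated_def nth_append)
  next
    case equal
    then show ?thesis using assms by simp
  next
    case greater
    then have "length u \<le> p" by simp
    then obtain r where r: "p = length u + r" using le_Suc_ex by blast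
    then have "d dvd Suc r" using uv p by (auto simp: dilated_def nth_append)
    then show ?thesis using r assms by (metis add_Suc_right dvd_add)
  qed
  then show "dilated d (u @ v)" using uv by (auto simp: dilated_def)
qed

section \<open>Weakly increasing words at roots of unity\<close>

lemma descent_words_empty:
  "descent_words k n {} = {w. length w = n \<and> set w \<subseteq> {..<k} \<and> sorted w}"
  by (auto simp: descent_words_def sorted_iff_nth_Suc not_less)

text \<open>The complete homogeneous symmetric polynomial of degree \<open>n\<close> at \<open>1, z, \<dots>, z ^ (k - 1)\<close>.\<close>

definition weighted_count :: "'a::comm_ring_1 \<Rightarrow> nat \<Rightarrow> nat \<Rightarrow> 'a" where
  "weighted_count z k n = (\<Sum>w\<in>descent_words k n {}. z ^ sum_list w)"

lemma weighted_count_0 [simp]: "weighted_count z k 0 = 1"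
proof -
  have "descent_words k 0 {} = {[]}" by (auto simp: descent_words_def)
  then show ?thesis by (simp add: weighted_count_def)
qed

lemma weighted_count_no_letters: "0 < n \<Longrightarrow> weighted_count z 0 n = 0"
proof -
  assume "0 < n"
  then have "descent_words 0 n {} = {}" by (auto simp: descent_words_def)
  then show ?thesis by (simp add: weighted_count_def)
qed

lemma descent_words_empty_last_letter:
  "descent_words (Suc k) (Suc n) {} =
     descent_words k (Suc n) {} \<union> (\<lambda>w. w @ [k]) ` descent_words (Suc k) n {}" (is "?L = ?R")
proof
  show "?L \<subseteq> ?R"
  proof
    fix w assume w: "w \<in> ?L"
    then have "w \<noteq> []" by (auto simp: descent_words_def)
    then obtain u x where ux: "w = u @ [x]" by (metis rev_exhaust)
    show "w \<in> ?R"
    proof (cases "x = k")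
      case True
      then show ?thesis using w ux
        by (auto simp: descent_words_empty sorted_append)
    next
      case False
      then have "x < k" using w ux by (auto simp: descent_words_empty)
      then have "w \<in> descent_words k (Suc n) {}"
        using w ux by (fastforce simp: descent_words_empty sorted_append)
      then show ?thesis by simp
    qed
  qed
  show "?R \<subseteq> ?L"
    by (auto simp: descent_words_empty sorted_append lessThan_Suc less_Suc_eq_le)
       (fastforce simp: less_imp_le)+
qed

lemma weighted_count_Suc:
  "weighted_count z (Suc k) (Suc n) =
     weighted_count z k (Suc n) + z ^ k * weighted_count z (Suc k) n"
proof -
  have disj: "descent_words k (Suc n) {} \<inter> (\<lambda>w. w @ [k]) ` descent_words (Suc k) n {} = {}"
    by (auto simp: descent_words_def)
  have "weighted_count z (Suc k) (Suc n) = weighted_count z k (Suc n) +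
      (\<Sum>w\<in>(\<lambda>w. w @ [k]) ` descent_words (Suc k) n {}. z ^ sum_list w)"
    unfolding weighted_count_def descent_words_empty_last_letter
    by (rule sum.union_disjoint) (use disj in auto)
  also have "(\<Sum>w\<in>(\<lambda>w. w @ [k]) ` descent_words (Suc k) n {}. z ^ sum_list w) =
      z ^ k * weighted_count z (Suc k) n"
    unfolding weighted_count_def sum_distrib_left
    by (subst sum.reindex) (auto simp: inj_on_def power_add mult.commute)
  finally show ?thesis .
qed

text \<open>The generating function of the complete homogeneous symmetric polynomials, cleared of
  denominators.\<close>

lemma fps_weighted_count:
  "Abs_fps (weighted_count z k) * fps_of_poly (\<Prod>i<k. [:1, - (z ^ i):]) = 1"
proof (induction k)
  case 0
  have "Abs_fps (weighted_count z 0) = 1"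
    by (rule fps_ext) (simp add: weighted_count_no_letters)
  then show ?case by simp
next
  case (Suc k)
  have "Abs_fps (weighted_count z (Suc k)) * fps_of_poly [:1, - (z ^ k):] =
      Abs_fps (weighted_count z k)"
  proof (rule fps_ext)
    fix n
    have "fps_of_poly [:1, - (z ^ k):] = 1 - fps_const (z ^ k) * fps_X"
      by (simp add: fps_of_poly_pCons)
    then have "Abs_fps (weighted_count z (Suc k)) * fps_of_poly [:1, - (z ^ k):] =
        Abs_fps (weighted_count z (Suc k)) -
        fps_const (z ^ k) * (Abs_fps (weighted_count z (Suc k)) * fps_X)"
      by (simp only: right_diff_distrib mult.left_commute mult_1_right)
    then show "fps_nth (Abs_fps (weighted_count z (Suc k)) * fps_of_poly [:1, - (z ^ k):]) n =
       fps_nth (Abs_fps (weighted_count z k)) n"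
      by (cases n) (simp_all add: weighted_count_Suc)
  qed
  moreover have "Abs_fps (weighted_count z (Suc k)) * fps_of_poly (\<Prod>i<Suc k. [:1, - (z ^ i):]) =
      Abs_fps (weighted_count z (Suc k)) * fps_of_poly [:1, - (z ^ k):] *
      fps_of_poly (\<Prod>i<k. [:1, - (z ^ i):])"
    by (simp only: prod.lessThan_Suc fps_of_poly_mult ac_simps)
  ultimately show ?case using Suc.IH by (simp only:)
qed

text \<open>Both sides have degree at most \<open>d\<close>, and they agree at \<open>0\<close> and at the \<open>d\<close> distinct powers of
  \<open>inverse z\<close>.\<close>

lemma prod_roots_of_unity:
  assumes "primitive_root_of_unity d z"
  shows "(\<Prod>i<d. [:1, - (z ^ i):]) = 1 - Polynomial.monom 1 d" (is "?L = ?R")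
proof -
  have d: "0 < d" and zd: "z ^ d = 1" and prim: "\<And>j. 0 < j \<Longrightarrow> j < d \<Longrightarrow> z ^ j \<noteq> 1"
    using assms by (auto simp: primitive_root_of_unity_def)
  have z0: "z \<noteq> 0" using d zd by (auto simp: power_0_left)
  define A where "A = insert 0 ((\<lambda>i. inverse z ^ i) ` {..<d})"
  have inj: "inj_on (\<lambda>i. inverse z ^ i) {..<d}"
  proof (rule linorder_inj_onI)
    fix i j assume ij: "i < j" "i \<in> {..<d}" "j \<in> {..<d}"
    show "inverse z ^ i \<noteq> inverse z ^ j"
    proof
      assume "inverse z ^ i = inverse z ^ j"
      then have "z ^ i = z ^ j" by (simp add: power_inverse)
      also have "z ^ j = z ^ i * z ^ (j - i)" using ij by (simp flip: power_add)
      finally have "z ^ (j - i) = 1" using z0 by simp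
      moreover have "0 < j - i" "j - i < d" using ij by auto
      ultimately show False using prim by blast
    qed
  qed auto
  have cA: "card A = Suc d"
    unfolding A_def using z0 by (subst card_insert_disjoint) (auto simp: card_image[OF inj])
  show ?thesis
  proof (rule poly_eqI_degree[of A])
    fix x assume "x \<in> A"
    then consider "x = 0" | i where "i < d" "x = inverse z ^ i" by (auto simp: A_def)
    then show "poly ?L x = poly ?R x"
    proof cases
      case 1
      then show ?thesis using d by (simp add: poly_prod poly_monom power_0_left)
    next
      case 2
      have "x ^ d = 1" using zd 2 by (simp add: power_inverse flip: power_mult)
           (simp add: power_mult mult.commute[of i])
      moreover have "poly ?L x = 0" using 2 z0
        by (auto simp: poly_prod power_inverse intro!: bexI[of _ i])
      ultimately show ?thesis by (simp add: poly_monom)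
    qed
  next
    have "degree ?L \<le> (\<Sum>i<d. degree [:1, - (z ^ i):])"
      using degree_prod_sum_le[of "{..<d}" "\<lambda>i. [:1, - (z ^ i):]"] by (simp add: o_def)
    also have "\<dots> \<le> (\<Sum>i<d. 1)" by (intro sum_mono) simp
    finally show "degree ?L < card A" using cA by simp
  next
    have "degree ?R \<le> d" by (rule degree_diff_le) (auto intro: degree_monom_le)
    then show "degree ?R < card A" using cA by simp
  qed
qed


text \<open>Write \<open>F k\<close> for the generating function and \<open>P k\<close> for its inverse. If \<open>d \<le> k\<close>, the first \<open>d\<close>
  factors of \<open>P k\<close> multiply to \<open>1 - X ^ d\<close> and the others form \<open>P (k - d)\<close>, so
  \<open>F k * (1 - X ^ d) = F (k - d)\<close>. If \<open>k < d\<close>, then \<open>F k * (1 - X ^ d)\<close> is a polynomial of degree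
  \<open>d - k < d\<close>, so its coefficient at \<open>n + d\<close> vanishes, as does \<open>weighted_count z 0 (n + d)\<close>.\<close>

lemma weighted_count_step:
  assumes z: "primitive_root_of_unity d z" and "0 < k"
  shows "weighted_count z k (n + d) = weighted_count z (k - d) (n + d) + weighted_count z k n"
proof -
  have d: "0 < d" and zd: "z ^ d = 1"
    using z by (auto simp: primitive_root_of_unity_def)
  define F where "F k = Abs_fps (weighted_count z k)" for k
  define P where "P k = (\<Prod>i<k. [:1, - (z ^ i):])" for k
  have split: "P (a + b) = P a * (\<Prod>i<b. [:1, - (z ^ (a + i)):])" for a b
    unfolding P_def
    by (induction b) (simp_all only: prod.lessThan_Suc add_Suc_right mult.assoc, simp)
  have FP: "F k * fps_of_poly (P k) = 1" for k
    unfolding F_def P_def by (rule fps_weighted_count)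
  have Pd: "P d = 1 - Polynomial.monom 1 d"
    unfolding P_def using z by (rule prod_roots_of_unity)
  have nth: "fps_nth (F k * fps_of_poly (P d)) (n + d) =
      weighted_count z k (n + d) - weighted_count z k n"
    by (simp add: Pd fps_of_poly_diff fps_of_poly_monom right_diff_distrib
        fps_X_power_mult_right_nth F_def)
  show ?thesis
  proof (cases "d \<le> k")
    case True
    have "P k = P d * P (k - d)"
      using split[of d "k - d"] True zd by (simp add: power_add P_def)
    then have "F k * fps_of_poly (P d) * fps_of_poly (P (k - d)) * F (k - d) = F (k - d)"
      using FP[of k] by (simp add: fps_of_poly_mult mult.assoc)
    then have "F k * fps_of_poly (P d) = F (k - d)"
      using FP[of "k - d"] by (simp add: mult.assoc mult.commute mult.left_commute)
    then show ?thesis using nth by (simp add: F_def)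
  next
    case False
    define Q where "Q = (\<Prod>i<d - k. [:1, - (z ^ (k + i)):])"
    have "P d = P k * Q" using split[of k "d - k"] False by (simp add: Q_def)
    then have "F k * fps_of_poly (P d) = fps_of_poly Q"
      using FP[of k] by (simp add: fps_of_poly_mult flip: mult.assoc)
    moreover have "degree Q < n + d"
    proof -
      have "degree Q \<le> (\<Sum>i<d - k. degree [:1, - (z ^ (k + i)):])"
        unfolding Q_def
        using degree_prod_sum_le[of "{..<d - k}" "\<lambda>i. [:1, - (z ^ (k + i)):]"] by (simp add: o_def)
      also have "\<dots> \<le> (\<Sum>i<d - k. 1)" by (intro sum_mono) simp
      finally show ?thesis using \<open>0 < k\<close> d by simp
    qed
    ultimately show ?thesis
      using nth False d by (simp add: coeff_eq_0 weighted_count_no_letters)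
  qed
qed

lemma dilated_block:
  assumes "dilated d v" "length v = d" "0 < d"
  shows "v = replicate d (hd v)"
proof -
  have const: "v ! p = v ! 0" if "p < d" for p
    using that
  proof (induction p)
    case (Suc p)
    then have "\<not> d dvd Suc p" by (auto dest: dvd_imp_le)
    then have "v ! p = v ! Suc p"
      using assms Suc.prems by (auto simp: dilated_def)
    then show ?case using Suc by simp
  qed simp
  have hd: "hd v = v ! 0" using assms by (intro hd_conv_nth) auto
  show ?thesis
  proof (rule nth_equalityI)
    fix p assume "p < length v"
    then show "v ! p = replicate d (hd v) ! p" using const[of p] hd assms(2) by simp
  qed (simp add: assms)
qed

text \<open>\<open>M\<close> is the largest multiple of \<open>d\<close> below \<open>k\<close>. Either the last block of a dilated increasing word
  consists of copies of \<open>M\<close> and can be removed, or all letters are multiples of \<open>d\<close> below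
  \<open>M\<close>; these are the multiples of \<open>d\<close> below \<open>k - d\<close>. Truncated subtraction covers the case
  \<open>k \<le> d\<close>, where \<open>M = 0\<close> and the second alternative is void.\<close>

lemma dilated_sorted_words_step:
  fixes k d n :: nat
  assumes "0 < d" "0 < k" "d dvd n"
  defines "M \<equiv> d * ((k - 1) div d)"
  shows "{w \<in> descent_words k (n + d) {}. dilated d w} =
    {w \<in> descent_words (k - d) (n + d) {}. dilated d w} \<union>
    (\<lambda>u. u @ replicate d M) ` {u \<in> descent_words k n {}. dilated d u}" (is "?L = ?A \<union> ?B")
proof -
  have "M \<le> k - 1" unfolding M_def by (rule times_div_less_eq_dividend)
  then have Mk: "M < k" using \<open>0 < k\<close> by linarith
  have max: "x \<le> M" if "d dvd x" "x < k" for x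
  proof -
    obtain y where y: "x = d * y" using \<open>d dvd x\<close> by blast
    then have "y * d \<le> k - 1" using that by (simp add: mult.commute)
    then have "y \<le> (k - 1) div d" using \<open>0 < d\<close> by (simp add: less_eq_div_iff_mult_less_eq)
    then show ?thesis by (simp add: y M_def)
  qed
  show ?thesis
  proof (intro equalityI subsetI)
    fix w assume w: "w \<in> ?L"
    define u v where "u = take n w" and "v = drop n w"
    have len: "length w = n + d" using w by (simp add: descent_words_def)
    have uv: "w = u @ v" "length u = n" "length v = d"
      using len by (auto simp: u_def v_def)
    then have dil: "dilated d u" "dilated d v"
      using w dilated_append[of d u v] \<open>d dvd n\<close> by auto
    define x where "x = hd v"
    have v: "v = replicate d x" unfolding x_def using dil uv assms by (intro dilated_block)
    then have xv: "x \<in> set v" using \<open>0 < d\<close> by simp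
    have x: "d dvd x" "x < k"
      using xv dil(2) w uv(1) by (auto simp: dilated_def descent_words_def)
    have sorted: "sorted w" "set w \<subseteq> {..<k}" using w by (auto simp: descent_words_empty)
    show "w \<in> ?A \<union> ?B"
    proof (cases "x = M")
      case True
      have "u \<in> descent_words k n {}"
        using sorted uv by (auto simp: descent_words_empty sorted_append)
      then show ?thesis using dil uv v True by auto
    next
      case False
      then have "x < M" using max[OF x] by simp
      moreover have "d dvd M" by (simp add: M_def)
      ultimately have "x + d \<le> M" using x(1)
        by (metis dvd_diff_nat dvd_imp_le le_diff_conv2 less_imp_le_nat zero_less_diff add.commute)
      then have "x < k - d" using Mk by simp
      moreover have "y \<le> x" if "y \<in> set w" for y
        using that sorted(1) xv v unfolding uv(1) by (auto simp: sorted_append)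
      ultimately have "w \<in> descent_words (k - d) (n + d) {}"
        using sorted len by (fastforce simp: descent_words_empty)
      then show ?thesis using w by simp
    qed
  next
    fix w assume "w \<in> ?A \<union> ?B"
    then show "w \<in> ?L"
    proof
      assume "w \<in> ?A"
      then show ?thesis by (fastforce simp: descent_words_empty)
    next
      assume "w \<in> ?B"
      then obtain u where u: "w = u @ replicate d M" "u \<in> descent_words k n {}" "dilated d u"
        by blast
      have "dilated d (replicate d M)" by (auto simp: dilated_def M_def)
      then have "dilated d w"
        using u \<open>d dvd n\<close> by (auto simp: dilated_append descent_words_def)
      moreover have "w \<in> descent_words k (n + d) {}"
        using u max Mk by (auto simp: descent_words_empty sorted_append dilated_def)
      ultimately show ?thesis by simp
    qed
  qed
qed

lemma card_dilated_sorted_words_step: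
  assumes "0 < d" "0 < k" "d dvd n"
  shows "card {w \<in> descent_words k (n + d) {}. dilated d w} =
    card {w \<in> descent_words (k - d) (n + d) {}. dilated d w} +
    card {w \<in> descent_words k n {}. dilated d w}"
proof -
  define M where "M = d * ((k - 1) div d)"
  have disj: "w \<notin> descent_words (k - d) (n + d) {}" if "w = u @ replicate d M" for u w
  proof -
    have "k - d \<le> M"
    proof -
      have "k - 1 < d * ((k - 1) div d) + d"
        using dividend_less_times_div[OF assms(1), of "k - 1"] by linarith
      then show ?thesis by (simp add: M_def)
    qed
    then show ?thesis using that assms(1) by (auto simp: descent_words_def)
  qed
  have "card {w \<in> descent_words k (n + d) {}. dilated d w} =
    card {w \<in> descent_words (k - d) (n + d) {}. dilated d w} +
    card ((\<lambda>u. u @ replicate d M) ` {u \<in> descent_words k n {}. dilated d u})"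
    unfolding dilated_sorted_words_step[OF assms] M_def[symmetric]
    by (rule card_Un_disjoint) (use disj in auto)
  moreover have "inj_on (\<lambda>u. u @ replicate d M) A" for A by (rule inj_onI) simp
  ultimately show ?thesis by (simp only: card_image)
qed

text \<open>Both sides satisfy the same recurrence and agree when \<open>k = 0\<close> or \<open>n = 0\<close>.\<close>

lemma weighted_count_eq_card_dilated:
  assumes z: "primitive_root_of_unity d z" and "d dvd n"
  shows "weighted_count z k n = of_nat (card {w \<in> descent_words k n {}. dilated d w})"
  using assms(2)
proof (induction "k + n" arbitrary: k n rule: less_induct)
  case less
  have d: "0 < d" using z by (auto simp: primitive_root_of_unity_def)
  consider "n = 0" | "0 < n" "k = 0" | "0 < n" "0 < k" by (metis not_gr_zero)
  then show ?case
  proof cases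
    case 1
    have "{w \<in> descent_words k 0 {}. dilated d w} = {[]}"
      by (auto simp: descent_words_def dilated_def)
    then show ?thesis using 1 by simp
  next
    case 2
    have "{w \<in> descent_words k n {}. dilated d w} = {}"
      using 2 by (auto simp: descent_words_def)
    then show ?thesis using 2 by (simp only: weighted_count_no_letters) simp
  next
    case 3
    define r where "r = n - d"
    have "d \<le> n" using 3 less.prems dvd_imp_le by blast
    then have n: "n = r + d" by (simp add: r_def)
    have r: "d dvd r" using less.prems n by simp
    have "weighted_count z k n = weighted_count z (k - d) n + weighted_count z k r"
      unfolding n using z 3 by (intro weighted_count_step)
    also have "weighted_count z (k - d) n =
        of_nat (card {w \<in> descent_words (k - d) n {}. dilated d w})"
      using 3 d less.prems by (intro less.hyps) auto
    also have "weighted_count z k r = of_nat (card {w \<in> descent_words k r {}. dilated d w})"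
      using d n r by (intro less.hyps) auto
    finally show ?thesis
      unfolding n using card_dilated_sorted_words_step[OF d \<open>0 < k\<close> r] by simp
  qed
qed

section \<open>Words with prescribed descents at roots of unity\<close>

theorem sum_root_of_unity_descent_words:
  assumes z: "primitive_root_of_unity d z"
    and "d dvd n" "S \<subseteq> {0<..<n}" "\<And>s. s \<in> S \<Longrightarrow> d dvd s"
  shows "(\<Sum>w\<in>descent_words k n S. z ^ sum_list w) =
         of_nat (card {w \<in> descent_words k n S. dilated d w})"
proof -
  have card: "(\<Sum>w\<in>A. of_bool (dilated d w)) = (of_nat (card {w \<in> A. dilated d w}) :: complex)"
    if "finite A" for A
    using that by (simp add: Collect_conj_eq)
  have "(\<Sum>w\<in>descent_words k n S. z ^ sum_list w) =
      (\<Sum>w\<in>descent_words k n S. of_bool (dilated d w))"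
  proof (rule sum_descent_words_cong[OF _ _ _ assms(2-4)])
    fix n assume "d dvd n"
    show "(\<Sum>w\<in>descent_words k n {}. z ^ sum_list w) =
        (\<Sum>w\<in>descent_words k n {}. of_bool (dilated d w))"
      using weighted_count_eq_card_dilated[OF z \<open>d dvd n\<close>, of k]
      unfolding weighted_count_def card[OF finite_descent_words] .
  qed (auto simp: power_add dilated_append)
  then show ?thesis unfolding card[OF finite_descent_words] .
qed

section \<open>Orbit sizes from values at roots of unity\<close>

lemma primitive_root_of_unity_iff:
  "primitive_root_of_unity d z \<longleftrightarrow> 0 < d \<and> (\<forall>t. z ^ t = 1 \<longleftrightarrow> d dvd t)"
proof
  assume z: "primitive_root_of_unity d z"
  have "z ^ t = 1 \<longleftrightarrow> d dvd t" for t
  proof -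
    have "z ^ t = z ^ (t mod d) * (z ^ d) ^ (t div d)"
      by (simp flip: power_mult power_add)
    then have "z ^ t = z ^ (t mod d)" using z by (simp add: primitive_root_of_unity_def)
    moreover have "t mod d < d" using z by (simp add: primitive_root_of_unity_def)
    ultimately show ?thesis
      using z by (cases "t mod d = 0") (auto simp: primitive_root_of_unity_def dvd_eq_mod_eq_0)
  qed
  then show "0 < d \<and> (\<forall>t. z ^ t = 1 \<longleftrightarrow> d dvd t)"
    using z by (simp add: primitive_root_of_unity_def)
next
  assume "0 < d \<and> (\<forall>t. z ^ t = 1 \<longleftrightarrow> d dvd t)"
  then show "primitive_root_of_unity d z"
    by (auto simp: primitive_root_of_unity_def dest: dvd_imp_le)
qed

lemma ex_primitive_root_of_unity:
  assumes "0 < m"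
  shows "\<exists>z. primitive_root_of_unity m z"
proof -
  define z where "z = cis (2 * pi / real m)"
  have "z ^ j \<noteq> 1" if j: "0 < j" "j < m" for j
  proof
    assume "z ^ j = 1"
    then have "(\<lambda>j. cis (2 * pi * real j / real m)) j = (\<lambda>j. cis (2 * pi * real j / real m)) 0"
      by (simp add: z_def DeMoivre mult.commute)
    moreover have "inj_on (\<lambda>j. cis (2 * pi * real j / real m)) {..<m}"
      using bij_betw_roots_unity[OF assms] by (simp add: bij_betw_def)
    ultimately show False using j by (metis inj_onD lessThan_iff less_irrefl less_trans)
  qed
  moreover have "z ^ m = 1" using assms by (simp add: z_def DeMoivre)
  ultimately have "primitive_root_of_unity m z"
    using assms by (simp add: primitive_root_of_unity_def)
  then show ?thesis ..
qed

lemma primitive_root_of_unity_power: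
  assumes "primitive_root_of_unity m z"
  shows "primitive_root_of_unity (m div gcd m j) (z ^ j)"
proof -
  have m: "0 < m" using assms by (simp add: primitive_root_of_unity_def)
  have "(z ^ j) ^ t = 1 \<longleftrightarrow> m div gcd m j dvd t" for t
  proof -
    have "(z ^ j) ^ t = 1 \<longleftrightarrow> m dvd j * t"
      using assms by (simp add: primitive_root_of_unity_iff flip: power_mult)
    also have "m dvd j * t \<longleftrightarrow> m div gcd m j dvd t"
      using m by (simp add: div_dvd_iff_mult gcd_mult_distrib_nat mult.commute)
    finally show ?thesis .
  qed
  then show ?thesis
    using m by (simp add: primitive_root_of_unity_iff div_greater_zero_iff gcd_le1_nat)
qed

lemma sum_powers_primitive_root:
  assumes z: "primitive_root_of_unity m z"
  shows "(\<Sum>j<m. z ^ (j * t)) = (if m dvd t then of_nat m else 0)"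
proof (cases "m dvd t")
  case True
  then have "z ^ (j * t) = 1" for j using z by (simp add: primitive_root_of_unity_iff)
  then show ?thesis using True by simp
next
  case False
  then have "z ^ t \<noteq> 1" using z by (simp add: primitive_root_of_unity_iff)
  moreover have "(z ^ t) ^ m = 1" using z by (simp add: primitive_root_of_unity_iff flip: power_mult)
  ultimately have "(\<Sum>j<m. (z ^ t) ^ j) = 0" by (simp add: geometric_sum)
  then show ?thesis using False by (simp add: mult.commute flip: power_mult)
qed

text \<open>The indices \<open>j\<close> in question are the multiples of \<open>m div e\<close>, so the sum runs over all powers of
  a primitive \<open>e\<close>-th root of unity.\<close>

lemma sum_restricted_powers_primitive_root:
  assumes z: "primitive_root_of_unity m z" and "e dvd m"
  shows "(\<Sum>j | j < m \<and> m dvd j * e. z ^ (j * t)) = (if e dvd t then of_nat e else 0)"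
proof -
  obtain l where m: "m = l * e" using assms(2) by (metis dvd_div_mult_self)
  have pos: "0 < l" "0 < e" using z m by (auto simp: primitive_root_of_unity_def)
  have "{j. j < m \<and> m dvd j * e} = (\<lambda>i. l * i) ` {..<e}"
    using pos by (auto simp: m dvd_def image_iff)
  then have "(\<Sum>j | j < m \<and> m dvd j * e. z ^ (j * t)) = (\<Sum>i<e. (z ^ l) ^ (i * t))"
    using pos by (simp add: sum.reindex inj_on_def mult.assoc flip: power_mult)
  moreover have "primitive_root_of_unity e (z ^ l)"
    using primitive_root_of_unity_power[OF z, of l] pos by (simp add: m)
  ultimately show ?thesis by (simp add: sum_powers_primitive_root)
qed

text \<open>The double sum of \<open>z ^ (j * (s x - i))\<close> over \<open>x \<in> X\<close> and \<open>j < m\<close>, for a primitive \<open>m\<close>-th root of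
  unity \<open>z\<close>, is computed in two ways. Summing over \<open>j\<close> first gives \<open>m\<close> times the number of \<open>x\<close> with
  \<open>s x\<close> congruent to \<open>i\<close>. Summing over \<open>x\<close> first and using the assumption on the values gives
  the sum of \<open>e x\<close> over the \<open>x\<close> with \<open>e x dvd i\<close>.\<close>

lemma level_set_weight_dvd:
  fixes s e :: "'x \<Rightarrow> nat"
  assumes "finite X" and "0 < m" and e: "\<And>x. x \<in> X \<Longrightarrow> e x dvd m"
    and evals: "\<And>d z. d dvd m \<Longrightarrow> primitive_root_of_unity d z \<Longrightarrow>
      (\<Sum>x\<in>X. z ^ s x) = of_nat (card {x \<in> X. d dvd e x})"
  shows "m dvd (\<Sum>x | x \<in> X \<and> e x dvd i. e x)"
proof -
  obtain z where z: "primitive_root_of_unity m z"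
    using ex_primitive_root_of_unity[OF assms(2)] by blast
  \<comment> \<open>\<open>t\<close> stands for \<open>- i\<close> modulo \<open>m\<close>.\<close>
  define t where "t = (m - 1) * i"
  have "t + i = m * i" using assms(2) by (cases m) (auto simp: t_def)
  then have dvd_t: "e x dvd t \<longleftrightarrow> e x dvd i" if "x \<in> X" for x
  proof -
    have "e x dvd t + i" using e[OF that] \<open>t + i = m * i\<close> by simp
    then show ?thesis by (metis dvd_add_left_iff dvd_add_right_iff)
  qed
  have inner: "(\<Sum>x\<in>X. z ^ (j * s x)) = (\<Sum>x\<in>X. of_bool (m dvd j * e x))" for j
  proof -
    have d: "m div gcd m j dvd m" by (metis dvd_div_mult_self dvd_triv_left gcd_dvd1)
    have *: "m div gcd m j dvd y \<longleftrightarrow> m dvd j * y" for y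
    proof -
      have "m div gcd m j dvd y \<longleftrightarrow> (z ^ j) ^ y = 1"
        using primitive_root_of_unity_power[OF z, of j] by (simp add: primitive_root_of_unity_iff)
      then show ?thesis using z by (simp add: primitive_root_of_unity_iff flip: power_mult)
    qed
    have "(\<Sum>x\<in>X. z ^ (j * s x)) = of_nat (card {x \<in> X. m div gcd m j dvd e x})"
      using evals[OF d primitive_root_of_unity_power[OF z]] by (simp add: power_mult)
    also have "\<dots> = (\<Sum>x\<in>X. of_bool (m dvd j * e x))"
      unfolding * using assms(1) by (simp add: Collect_conj_eq)
    finally show ?thesis .
  qed
  have "of_nat (m * card {x \<in> X. m dvd s x + t}) =
      (\<Sum>x\<in>X. \<Sum>j<m. z ^ (j * (s x + t)))"
    using assms(1) by (simp add: sum_powers_primitive_root[OF z] sum.If_cases Collect_conj_eq)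
  also have "\<dots> = (\<Sum>j<m. z ^ (j * t) * (\<Sum>x\<in>X. z ^ (j * s x)))"
    by (subst sum.swap)
       (simp add: sum_distrib_left distrib_left power_add mult.commute)
  also have "\<dots> = (\<Sum>x\<in>X. \<Sum>j<m. if m dvd j * e x then z ^ (j * t) else 0)"
    unfolding inner by (subst sum.swap) (simp only: sum_distrib_left of_bool_def if_distrib[of "(*) _"]
        mult_1_right mult_zero_right)
  also have "\<dots> = (\<Sum>x\<in>X. \<Sum>j | j < m \<and> m dvd j * e x. z ^ (j * t))"
  proof (rule sum.cong [OF refl])
    fix x
    have "{j. j < m \<and> m dvd j * e x} = {j \<in> {..<m}. m dvd j * e x}" by auto
    then show "(\<Sum>j<m. if m dvd j * e x then z ^ (j * t) else 0) =
        (\<Sum>j | j < m \<and> m dvd j * e x. z ^ (j * t))"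
      by (simp only: sum.inter_filter finite_lessThan)
  qed
  also have "\<dots> = (\<Sum>x\<in>X. if e x dvd i then of_nat (e x) else 0)"
    using e dvd_t by (intro sum.cong refl) (simp add: sum_restricted_powers_primitive_root[OF z])
  also have "\<dots> = of_nat (\<Sum>x | x \<in> X \<and> e x dvd i. e x)"
    using assms(1) by (auto simp: sum.inter_filter intro!: sum.cong)
  finally have "m * card {x \<in> X. m dvd s x + t} = (\<Sum>x | x \<in> X \<and> e x dvd i. e x)"
    using of_nat_eq_iff by blast
  then show ?thesis by (metis dvd_triv_left)
qed

text \<open>In the sum of \<open>e x\<close> over \<open>e x dvd i\<close>, the level sets of proper divisors of \<open>i\<close> contribute
  multiples of \<open>m\<close> by induction, so the level set of \<open>i\<close> does too: \<open>m\<close> divides \<open>i\<close> times its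
  cardinality.\<close>

lemma card_level_set_dvd:
  fixes e :: "'x \<Rightarrow> nat"
  assumes "finite X" and "0 < m"
    and wt: "\<And>i. m dvd (\<Sum>x | x \<in> X \<and> e x dvd i. e x)"
    and "i dvd m"
  shows "m div i dvd card {x \<in> X. e x = i}"
proof -
  have "m dvd i * card {x \<in> X. e x = i}" using assms(4)
  proof (induction i rule: less_induct)
    case (less i)
    have i: "0 < i" using less.prems assms(2) by (metis dvd_0_left_iff not_gr_zero)
    let ?Y = "{x \<in> X. e x dvd i \<and> e x \<noteq> i}"
    have "(\<Sum>x | x \<in> X \<and> e x dvd i. e x) = (\<Sum>x\<in>{x \<in> X. e x = i} \<union> ?Y. e x)"
      by (rule sum.cong) auto
    also have "\<dots> = (\<Sum>x | x \<in> X \<and> e x = i. e x) + (\<Sum>x\<in>?Y. e x)"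
      using assms(1) by (intro sum.union_disjoint) auto
    finally have split: "(\<Sum>x | x \<in> X \<and> e x dvd i. e x) =
      i * card {x \<in> X. e x = i} + (\<Sum>x\<in>?Y. e x)" by simp
    have "(\<Sum>x\<in>?Y. e x) = (\<Sum>t | t dvd i \<and> t \<noteq> i. \<Sum>x | x \<in> ?Y \<and> e x = t. e x)"
      using assms(1) i by (intro sum.group [symmetric]) auto
    also have "\<dots> = (\<Sum>t | t dvd i \<and> t \<noteq> i. t * card {x \<in> X. e x = t})"
    proof (intro sum.cong refl)
      fix t assume t: "t \<in> {t. t dvd i \<and> t \<noteq> i}"
      then have "{x \<in> ?Y. e x = t} = {x \<in> X. e x = t}" by auto
      then show "(\<Sum>x | x \<in> ?Y \<and> e x = t. e x) = t * card {x \<in> X. e x = t}" by simp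
    qed
    also have "m dvd \<dots>"
    proof (intro dvd_sum)
      fix t assume t: "t \<in> {t. t dvd i \<and> t \<noteq> i}"
      then have "t < i" using i by (auto dest: dvd_imp_le)
      then show "m dvd t * card {x \<in> X. e x = t}"
        using less.IH[of t] less.prems t dvd_trans[of t i m] by simp
    qed
    finally have Y: "m dvd (\<Sum>x\<in>?Y. e x)" .
    show ?case using wt[of i] unfolding split dvd_add_left_iff[OF Y] .
  qed
  moreover have "m = i * (m div i)" "i \<noteq> 0" using assms(2,4) by auto
  ultimately show ?thesis by (metis dvd_times_left_cancel_iff)
qed

section \<open>Cyclic actions with prescribed stabilizers\<close>

text \<open>Number the elements of \<open>Y\<close>, split the numbers into blocks of length \<open>l\<close>, and rotate each
  block.\<close>

lemma ex_free_rotation: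
  fixes Y :: "'x set"
  assumes "finite Y" "0 < l" "l dvd card Y"
  shows "\<exists>r :: nat \<Rightarrow> 'x \<Rightarrow> 'x. \<forall>y\<in>Y. \<forall>i.
    r i y \<in> Y \<and> (\<forall>j. r (i + j) y = r i (r j y)) \<and> (r i y = y \<longleftrightarrow> l dvd i)"
proof -
  obtain q where q: "card Y = q * l" using assms(3) by (metis dvd_div_mult_self)
  obtain h where h: "bij_betw h Y {..<card Y}"
    using ex_bij_betw_finite_nat[OF assms(1)] by (auto simp: atLeast0LessThan)
  define s where "s i t = (t div l) * l + (t + i) mod l" for i t
  have div: "s i t div l = t div l" and mod: "s i t mod l = (t + i) mod l" for i t
    using assms(2) by (simp_all add: s_def)
  have eqI: "a = b" if "a div l = b div l" "a mod l = b mod l" for a b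
    using that by (metis div_mult_mod_eq)
  have s_less: "s i t < card Y" if "t < card Y" for i t
  proof -
    have "t div l < q" using that q assms(2) by (simp add: less_mult_imp_div_less)
    then have "s i t div l < q" by (simp only: div)
    then show ?thesis unfolding q using assms(2) by (simp only: div_less_iff_less_mult)
  qed
  have s_add: "s (i + j) t = s i (s j t)" for i j t
  proof (rule eqI)
    have "s i (s j t) mod l = (s j t mod l + i) mod l" by (simp only: mod[of i] mod_add_left_eq)
    also have "\<dots> = (t + j + i) mod l" by (simp only: mod[of j] mod_add_left_eq)
    also have "t + j + i = t + (i + j)" by simp
    finally show "s (i + j) t mod l = s i (s j t) mod l" by (simp only: mod)
  qed (simp only: div)
  have s_fix: "s i t = t \<longleftrightarrow> l dvd i" for i t
  proof -
    have "s i t = t \<longleftrightarrow> (t + i) mod l = t mod l" using eqI div mod by metis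
    also have "\<dots> \<longleftrightarrow> l dvd i" using mod_eq_dvd_iff_nat[of t "t + i" l] by simp
    finally show ?thesis .
  qed
  define r where "r i y = inv_into Y h (s i (h y))" for i y
  have hr: "h (r i y) = s i (h y)" and rY: "r i y \<in> Y" if "y \<in> Y" for i y
  proof -
    have "s i (h y) \<in> h ` Y" using h that s_less by (auto simp: bij_betw_def)
    then show "h (r i y) = s i (h y)" "r i y \<in> Y"
      by (auto simp: r_def f_inv_into_f inv_into_into)
  qed
  have inj: "inj_on h Y" using h by (simp add: bij_betw_def)
  have "r (i + j) y = r i (r j y)" if "y \<in> Y" for i j y
    by (rule inj_onD[OF inj]) (simp_all add: hr rY s_add that)
  moreover have "r i y = y \<longleftrightarrow> l dvd i" if "y \<in> Y" for i y
    using inj_onD[OF inj, of "r i y" y] hr[OF that] rY[OF that] s_fix that by metis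
  ultimately show ?thesis using rY by blast
qed

text \<open>Each level set of \<open>e\<close> is rotated in cycles of length \<open>m div e x\<close>; then \<open>r i x = x\<close> if and only
  if \<open>m div e x\<close> divides \<open>i\<close>, which is the stated condition.\<close>

lemma ex_rotation_with_stabilizers:
  fixes X :: "'x set" and e :: "'x \<Rightarrow> nat"
  assumes "finite X" "0 < m" and e: "\<And>x. x \<in> X \<Longrightarrow> e x dvd m"
    and lev: "\<And>i. i dvd m \<Longrightarrow> m div i dvd card {x \<in> X. e x = i}"
  shows "\<exists>r :: nat \<Rightarrow> 'x \<Rightarrow> 'x. \<forall>x\<in>X. \<forall>i.
    r i x \<in> X \<and> (\<forall>j. r (i + j) x = r i (r j x)) \<and> (r i x = x \<longleftrightarrow> m dvd i * e x)"
proof -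
  define rot where "rot n r \<longleftrightarrow> (\<forall>y\<in>{x \<in> X. e x = n}. \<forall>i.
    r i y \<in> {x \<in> X. e x = n} \<and> (\<forall>j. r (i + j) y = r i (r j y)) \<and> (r i y = y \<longleftrightarrow> m div n dvd i))"
    for n and r :: "nat \<Rightarrow> 'x \<Rightarrow> 'x"
  have "\<exists>r. rot n r" if "n dvd m" for n
  proof -
    have "0 < m div n" using that assms(2) by (metis dvd_div_eq_0_iff not_gr_zero)
    then show ?thesis
      unfolding rot_def using assms(1) lev[OF that] by (intro ex_free_rotation) simp_all
  qed
  then obtain R where "\<And>n. n dvd m \<Longrightarrow> rot n (R n)" by metis
  note R = this[unfolded rot_def]
  have "R (e x) i x \<in> X \<and> (\<forall>j. R (e x) (i + j) x = R (e (R (e x) j x)) i (R (e x) j x)) \<and>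
      (R (e x) i x = x \<longleftrightarrow> m dvd i * e x)" if "x \<in> X" for x i
  proof -
    have 1: "R (e x) i x \<in> X" "e (R (e x) i x) = e x" "R (e x) (i + j) x = R (e x) i (R (e x) j x)"
      "R (e x) i x = x \<longleftrightarrow> m div e x dvd i" for i j
      using R[OF e[OF that]] that by auto
    have "e x \<noteq> 0" using e[OF that] assms(2) by auto
    then have "m div e x dvd i \<longleftrightarrow> m dvd i * e x" using e[OF that] by (simp add: div_dvd_iff_mult)
    then show ?thesis using 1 by simp
  qed
  then show ?thesis by (intro exI[of _ "\<lambda>i x. R (e x) i x"]) simp
qed

lemma (in group) cyclic_group_discrete_log:
  assumes "cyclic_group G" "order G = m" "0 < m"
  shows "\<exists>g\<in>carrier G. ord g = m \<and> (\<forall>c\<in>carrier G. \<exists>i::nat. c = g [^] i)"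
proof -
  have fin: "finite (carrier G)" using assms(2,3) order_gt_0_iff_finite by blast
  obtain g where g: "g \<in> carrier G" "subgroup_generated G {g} = G"
    using assms(1) by (auto simp: cyclic_group_def)
  then have gen: "generate G {g} = carrier G"
    by (metis Int_insert_right_if1 Int_empty_right carrier_subgroup_generated)
  then have "ord g = m" using generate_pow_card[OF g(1)] assms(2) by (simp add: order_def)
  moreover have "\<exists>i::nat. c = g [^] i" if "c \<in> carrier G" for c
    using generate_pow_on_finite_carrier[OF fin g(1)] that gen by auto
  ultimately show ?thesis using g(1) by blast
qed

text \<open>Fix a generator \<open>g\<close> and let \<open>g\<close> to the power \<open>i\<close> act as the rotation by \<open>i\<close> steps. Rotation by \<open>m\<close>
  steps is trivial, so the choice of exponent does not matter.\<close>

lemma ex_cyclic_action: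
  fixes X :: "'x set" and e :: "'x \<Rightarrow> nat" and C :: "'c monoid"
  assumes "group C" "cyclic_group C" "Coset.order C = m" "0 < m"
    and X: "finite X" and e: "\<And>x. x \<in> X \<Longrightarrow> e x dvd m"
    and lev: "\<And>i. i dvd m \<Longrightarrow> m div i dvd card {x \<in> X. e x = i}"
  shows "\<exists>act. group_action C X act \<and>
    (\<forall>c\<in>carrier C. \<forall>x\<in>X. act c x = x \<longleftrightarrow> group.ord C c dvd e x)"
proof -
  interpret group C by fact
  obtain g where g: "g \<in> carrier C" "ord g = m" and gpow: "\<And>c. c \<in> carrier C \<Longrightarrow> \<exists>i::nat. c = g [^]\<^bsub>C\<^esub> i"
    using cyclic_group_discrete_log[OF assms(2-4)] by blast
  obtain L where L: "\<And>c. c \<in> carrier C \<Longrightarrow> c = g [^]\<^bsub>C\<^esub> (L c :: nat)"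
    using gpow by metis
  obtain r :: "nat \<Rightarrow> 'x \<Rightarrow> 'x" where r: "\<forall>x\<in>X. \<forall>i.
      r i x \<in> X \<and> (\<forall>j. r (i + j) x = r i (r j x)) \<and> (r i x = x \<longleftrightarrow> m dvd i * e x)"
    using ex_rotation_with_stabilizers[OF X assms(4) e lev] by blast
  have rX: "r i x \<in> X" and radd: "r (i + j) x = r i (r j x)" and rfix: "r i x = x \<longleftrightarrow> m dvd i * e x"
    if "x \<in> X" for x i j using r that by auto
  have rm: "r (m * t) x = x" if "x \<in> X" for x t using rfix[OF that] by simp
  have rcong: "r i x = r j x" if "g [^]\<^bsub>C\<^esub> i = g [^]\<^bsub>C\<^esub> j" "x \<in> X" for i j :: nat and x
  proof -
    have *: "r j x = r i x" if "i \<le> j" "g [^]\<^bsub>C\<^esub> i = g [^]\<^bsub>C\<^esub> j" for i j :: nat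
    proof -
      have "m dvd j - i" using that g pow_eq_div2[of g j i] pow_eq_id by metis
      then obtain t where "j - i = m * t" by (elim dvdE)
      then have "j = i + m * t" using that(1) by simp
      then show ?thesis using radd[OF \<open>x \<in> X\<close>, of i "m * t"] rm[OF \<open>x \<in> X\<close>] by simp
    qed
    show ?thesis
    proof (cases "i \<le> j")
      case True
      show ?thesis by (rule sym [OF *[OF True that(1)]])
    next
      case False
      then show ?thesis using that(1) by (intro *) simp_all
    qed
  qed
  have bij: "bij_betw (r i) X X" for i
  proof -
    have "inj_on (r i) X"
    proof (rule inj_onI)
      fix x y assume xy: "x \<in> X" "y \<in> X" "r i x = r i y"
      \<comment> \<open>Rotation by \<open>i * (m - 1)\<close> steps inverts rotation by \<open>i\<close> steps.\<close>
      have "r (i * (m - 1)) (r i x) = x" if "x \<in> X" for x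
      proof -
        have "i * (m - 1) + i = m * i" using assms(4) by (cases m) auto
        then show ?thesis using radd[OF that, of "i * (m - 1)" i] rm[OF that, of i] by simp
      qed
      then show "x = y" using xy by metis
    qed
    then show ?thesis using X rX by (simp add: bij_betw_def endo_inj_surj image_subset_iff)
  qed
  define act where "act c = restrict (r (L c)) X" for c
  have actBij: "act c \<in> Bij X" for c
    using bij[of "L c"] unfolding Bij_def act_def
    by (auto simp: bij_betw_def inj_on_def)
  have "group_hom C (BijGroup X) act"
  proof (rule group_hom.intro[OF assms(1) group_BijGroup], unfold group_hom_axioms_def, rule homI)
    fix c assume "c \<in> carrier C"
    then show "act c \<in> carrier (BijGroup X)" using actBij by (simp add: BijGroup_def)
  next
    fix c c' assume c: "c \<in> carrier C" "c' \<in> carrier C"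
    have pow: "g [^]\<^bsub>C\<^esub> L (c \<otimes>\<^bsub>C\<^esub> c') = g [^]\<^bsub>C\<^esub> (L c + L c')"
      using c g L by (metis m_closed nat_pow_mult)
    have "r (L (c \<otimes>\<^bsub>C\<^esub> c')) x = r (L c) (r (L c') x)" if "x \<in> X" for x
      by (rule trans[OF rcong[OF pow that] radd[OF that]])
    then have "act (c \<otimes>\<^bsub>C\<^esub> c') = compose X (act c) (act c')"
      using rX by (auto simp: act_def compose_def fun_eq_iff)
    then show "act (c \<otimes>\<^bsub>C\<^esub> c') = act c \<otimes>\<^bsub>BijGroup X\<^esub> act c'"
      using actBij by (simp add: BijGroup_def)
  qed
  then have "group_action C X act" by (rule group_action.intro)
  moreover have "act c x = x \<longleftrightarrow> ord c dvd e x" if c: "c \<in> carrier C" and x: "x \<in> X" for c x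
  proof -
    have "ord c dvd e x \<longleftrightarrow> g [^]\<^bsub>C\<^esub> (L c * e x) = \<one>\<^bsub>C\<^esub>"
      using pow_eq_id[OF c] L[OF c] g by (metis nat_pow_pow)
    also have "\<dots> \<longleftrightarrow> m dvd L c * e x" using pow_eq_id[OF g(1)] g(2) by simp
    finally show ?thesis using rfix[OF x] x by (simp add: act_def)
  qed
  ultimately show ?thesis by blast
qed

lemma poly_sum_monom:
  fixes z :: complex
  shows "poly (map_poly of_int (\<Sum>x\<in>A. Polynomial.monom 1 (s x))) z = (\<Sum>x\<in>A. z ^ s x)"
proof -
  have add: "map_poly of_int (p + q) = map_poly of_int p + (map_poly of_int q :: complex poly)" for p q
    by (rule poly_eqI) (simp add: coeff_map_poly)
  show ?thesis
    by (induction A rule: infinite_finite_induct) (simp_all add: add map_poly_monom poly_monom)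
qed

text \<open>A criterion for the existence of a cyclic action that exhibits the sieving phenomenon: the
  values of the polynomial at roots of unity count the points whose intended stabilizer order
  \<open>e x\<close> is a multiple of \<open>d\<close>. That the polynomial has integer coefficients is what makes each
  level set of \<open>e\<close> split evenly into orbits of the intended length.\<close>

theorem ex_cyclic_sieving:
  fixes X :: "'x set" and s e :: "'x \<Rightarrow> nat" and C :: "'c monoid"
  assumes C: "group C" "cyclic_group C" "Coset.order C = m" "0 < m"
    and X: "finite X" and e: "\<And>x. x \<in> X \<Longrightarrow> e x dvd m"
    and evals: "\<And>d z. d dvd m \<Longrightarrow> primitive_root_of_unity d z \<Longrightarrow>
      (\<Sum>x\<in>X. z ^ s x) = of_nat (card {x \<in> X. d dvd e x})"
  shows "\<exists>act. group_action C X act \<and>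
           cyclic_sieving X C act (\<Sum>x\<in>X. Polynomial.monom 1 (s x))"
proof -
  interpret group C by (rule C(1))
  have "m dvd (\<Sum>x | x \<in> X \<and> e x dvd i. e x)" for i
    by (rule level_set_weight_dvd [OF X C(4) e evals])
  then have lev: "m div i dvd card {x \<in> X. e x = i}" if "i dvd m" for i
    using card_level_set_dvd [OF X C(4)] that by blast
  obtain act where act: "group_action C X act"
      "\<And>c x. c \<in> carrier C \<Longrightarrow> x \<in> X \<Longrightarrow> act c x = x \<longleftrightarrow> ord c dvd e x"
    using ex_cyclic_action [OF C X e lev] by blast
  have fin: "finite (carrier C)" using C(3,4) order_gt_0_iff_finite by blast
  have "of_nat (card {x \<in> X. act c x = x}) =
      poly (map_poly of_int (\<Sum>x\<in>X. Polynomial.monom 1 (s x))) z"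
    if c: "c \<in> carrier C" and z: "primitive_root_of_unity (ord c) z" for c z
  proof -
    have "ord c dvd m" using ord_dvd_group_order [OF c] C(3) by simp
    then have "(\<Sum>x\<in>X. z ^ s x) = of_nat (card {x \<in> X. ord c dvd e x})"
      using z by (rule evals)
    moreover have "{x \<in> X. ord c dvd e x} = {x \<in> X. act c x = x}" using act(2) [OF c] by blast
    ultimately show ?thesis by (simp only: poly_sum_monom)
  qed
  moreover have "0 \<le> Polynomial.coeff (\<Sum>x\<in>X. Polynomial.monom 1 (s x) :: int poly) n" for n
    by (simp add: coeff_sum sum_nonneg)
  ultimately have "cyclic_sieving X C act (\<Sum>x\<in>X. Polynomial.monom 1 (s x))"
    unfolding cyclic_sieving_def using X fin C(2) act(1) by blast
  then show ?thesis using act(1) by blast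
qed

section \<open>Reading words of border strips\<close>

text \<open>The number of cells strictly below row \<open>i\<close>. Row \<open>i\<close> thus occupies the positions from
  \<open>row_offset lam mu i\<close> on in the reading order from bottom to top. The restriction to nonzero parts
  keeps the index set finite.\<close>

definition row_offset :: "(nat \<Rightarrow> nat) \<Rightarrow> (nat \<Rightarrow> nat) \<Rightarrow> nat \<Rightarrow> nat" where
  "row_offset lam mu i = (\<Sum>r | i < r \<and> lam r \<noteq> 0. lam r - mu r)"

definition cell_position :: "(nat \<Rightarrow> nat) \<Rightarrow> (nat \<Rightarrow> nat) \<Rightarrow> nat \<times> nat \<Rightarrow> nat" where
  "cell_position lam mu = (\<lambda>(i, j). row_offset lam mu i + (j - mu i))"

lemma row_offset_rec:
  assumes "skew_partition lam mu"
  shows "row_offset lam mu i = row_offset lam mu (Suc i) + (lam (Suc i) - mu (Suc i))"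
proof -
  have fin: "finite {r. P r \<and> lam r \<noteq> 0}" for P
    using assms by (auto simp: skew_partition_def is_partition_def intro: rev_finite_subset)
  show ?thesis
  proof (cases "lam (Suc i) = 0")
    case True
    then have "{r. i < r \<and> lam r \<noteq> 0} = {r. Suc i < r \<and> lam r \<noteq> 0}"
      by (metis Suc_lessD Suc_lessI)
    then show ?thesis using True by (simp add: row_offset_def)
  next
    case False
    then have "{r. i < r \<and> lam r \<noteq> 0} = insert (Suc i) {r. Suc i < r \<and> lam r \<noteq> 0}"
      by (auto intro: Suc_lessI)
    then show ?thesis using fin by (simp add: row_offset_def)
  qed
qed

lemma row_offset_le:
  assumes "skew_partition lam mu" and "i < r"
  shows "row_offset lam mu r + (lam r - mu r) \<le> row_offset lam mu i"
  using assms(2)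
proof (induction r rule: less_Suc_induct)
  case (1 i)
  then show ?case using row_offset_rec[OF assms(1), of i] by simp
qed simp

lemma row_offset_eventually_0:
  assumes "skew_partition lam mu"
  shows "\<exists>i. row_offset lam mu i = 0"
proof -
  have "finite {r. lam r \<noteq> 0}" using assms by (simp add: skew_partition_def is_partition_def)
  then obtain N where N: "\<And>r. lam r \<noteq> 0 \<Longrightarrow> r \<le> N" by (auto simp: finite_nat_set_iff_bounded_le)
  have "{r. N < r \<and> lam r \<noteq> 0} = {}" using N by (auto simp: not_less)
  then have "row_offset lam mu N = 0" by (simp add: row_offset_def)
  then show ?thesis ..
qed

lemma mem_skew_diagram: "(i, j) \<in> skew_diagram lam mu \<longleftrightarrow> mu i \<le> j \<and> j < lam i"
  by (simp add: skew_diagram_def)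

lemma cell_position_bounds:
  assumes "(i, j) \<in> skew_diagram lam mu"
  shows "row_offset lam mu i \<le> cell_position lam mu (i, j)"
    and "cell_position lam mu (i, j) < row_offset lam mu i + (lam i - mu i)"
  using assms by (auto simp: cell_position_def mem_skew_diagram)

text \<open>The intervals of positions occupied by the rows are disjoint and adjacent. The row of a given
  position \<open>p\<close> is the first one that has at most \<open>p\<close> cells below it.\<close>

lemma bij_betw_cell_position:
  assumes "skew_partition lam mu"
  shows "bij_betw (cell_position lam mu) (skew_diagram lam mu)
           {..<row_offset lam mu 0 + (lam 0 - mu 0)}"
proof -
  let ?B = "row_offset lam mu" and ?pos = "cell_position lam mu"
  have "inj_on ?pos (skew_diagram lam mu)"
  proof (rule inj_onI)
    fix c c' assume c: "c \<in> skew_diagram lam mu" "c' \<in> skew_diagram lam mu" "?pos c = ?pos c'"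
    obtain i j i' j' where ij: "c = (i, j)" "c' = (i', j')" by fastforce
    \<comment> \<open>Distinct rows occupy disjoint intervals of positions.\<close>
    have "\<not> i < i'" "\<not> i' < i"
      using row_offset_le[OF assms, of i i'] row_offset_le[OF assms, of i' i]
        cell_position_bounds[of i j lam mu] cell_position_bounds[of i' j' lam mu] c unfolding ij by fastforce+
    then show "c = c'" using c by (auto simp: ij cell_position_def mem_skew_diagram)
  qed
  moreover have "?pos c < ?B 0 + (lam 0 - mu 0)" if "c \<in> skew_diagram lam mu" for c
  proof -
    obtain i j where c: "c = (i, j)" by fastforce
    show ?thesis
      using cell_position_bounds(2)[of i j lam mu] row_offset_le[OF assms, of 0 i] that unfolding c
      by (cases "i = 0") auto
  qed
  moreover have "\<exists>c\<in>skew_diagram lam mu. p = ?pos c" if p: "p < ?B 0 + (lam 0 - mu 0)" for p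
  proof -
    define i where "i = (LEAST i. ?B i \<le> p)"
    have ex: "\<exists>i. ?B i \<le> p" using row_offset_eventually_0[OF assms] by (metis le0)
    then have le: "?B i \<le> p" unfolding i_def by (rule LeastI_ex)
    have "p < ?B i + (lam i - mu i)"
    proof (cases i)
      case (Suc r)
      then have "\<not> ?B r \<le> p" unfolding i_def by (metis not_less_Least lessI)
      then show ?thesis using row_offset_rec[OF assms, of r] Suc by simp
    qed (use p in simp)
    then have "(i, p - ?B i + mu i) \<in> skew_diagram lam mu" "p = ?pos (i, p - ?B i + mu i)"
      using le by (auto simp: mem_skew_diagram cell_position_def)
    then show ?thesis by blast
  qed
  ultimately show ?thesis by (auto simp: bij_betw_def image_iff)
qed

lemma finite_skew_diagram: "skew_partition lam mu \<Longrightarrow> finite (skew_diagram lam mu)"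
  using bij_betw_finite[OF bij_betw_cell_position] by blast

lemma card_skew_diagram:
  "skew_partition lam mu \<Longrightarrow> card (skew_diagram lam mu) = row_offset lam mu 0 + (lam 0 - mu 0)"
  using bij_betw_same_card[OF bij_betw_cell_position] by simp

lemma bij_betw_cell_position_card:
  "skew_partition lam mu \<Longrightarrow>
    bij_betw (cell_position lam mu) (skew_diagram lam mu) {..<card (skew_diagram lam mu)}"
  using bij_betw_cell_position by (simp add: card_skew_diagram)

lemma cell_position_less:
  "skew_partition lam mu \<Longrightarrow> c \<in> skew_diagram lam mu \<Longrightarrow>
    cell_position lam mu c < card (skew_diagram lam mu)"
  using bij_betw_cell_position_card by (auto simp: bij_betw_def)

lemma position_cell:
  assumes "skew_partition lam mu" "p < card (skew_diagram lam mu)"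
  obtains c where "c \<in> skew_diagram lam mu" "p = cell_position lam mu c"
proof -
  have "p \<in> cell_position lam mu ` skew_diagram lam mu"
    using bij_betw_imp_surj_on[OF bij_betw_cell_position_card[OF assms(1)]] assms(2) by simp
  then show thesis using that by blast
qed

definition row_starts :: "(nat \<Rightarrow> nat) \<Rightarrow> (nat \<Rightarrow> nat) \<Rightarrow> nat set" where
  "row_starts lam mu = range (row_offset lam mu) \<inter> {0<..<card (skew_diagram lam mu)}"

lemma dvd_row_offset: "\<forall>i. m dvd lam i - mu i \<Longrightarrow> m dvd row_offset lam mu i"
  unfolding row_offset_def by (blast intro: dvd_sum)

text \<open>Two consecutive rows share at most one column, since two shared columns contain a 2 by 2
  square.\<close>

lemma border_strip_overlap_le:
  assumes "border_strip lam mu"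
  shows "lam (Suc i) \<le> Suc (mu i)"
proof (rule ccontr)
  assume "\<not> lam (Suc i) \<le> Suc (mu i)"
  moreover have "mu (Suc i) \<le> mu i" "lam (Suc i) \<le> lam i"
    using assms by (auto simp: border_strip_def skew_partition_def is_partition_def antimonoD)
  ultimately have "{(i, mu i), (i, Suc (mu i)), (Suc i, mu i), (Suc i, Suc (mu i))}
      \<subseteq> skew_diagram lam mu"
    by (auto simp: mem_skew_diagram)
  then show False using assms unfolding border_strip_def by blast
qed

text \<open>A path from a row up to \<open>i\<close> to a row beyond \<open>i\<close> has to make a vertical step between
  rows \<open>i\<close> and \<open>Suc i\<close>.\<close>

lemma connected_cells_crossing:
  assumes "connected_cells D" "c \<in> D" "d \<in> D" "fst c \<le> i" "i < fst d"
  shows "\<exists>j. (i, j) \<in> D \<and> (Suc i, j) \<in> D"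
proof -
  have "(c, d) \<in> {(a, b). a \<in> D \<and> b \<in> D \<and> adjacent_cells a b}\<^sup>*"
    using assms by (simp add: connected_cells_def)
  then have "fst d \<le> i \<or> (\<exists>j. (i, j) \<in> D \<and> (Suc i, j) \<in> D)"
  proof (induction rule: rtrancl_induct)
    case base
    then show ?case using assms(4) by simp
  next
    case (step a b)
    show ?case
    proof (cases "fst a \<le> i \<and> i < fst b")
      case True
      obtain a1 a2 b1 b2 where ab: "a = (a1, a2)" "b = (b1, b2)" by fastforce
      have "a1 = i" "b1 = Suc i" "b2 = a2" "a \<in> D" "b \<in> D"
        using True step.hyps(2) by (auto simp: ab adjacent_cells_def)
      then show ?thesis using ab by blast
    next
      case False
      then show ?thesis using step.IH by auto
    qed
  qed
  then show ?thesis using assms(5) by simp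
qed

text \<open>Between two occupied rows, connectedness forces consecutive rows to share a column, hence
  exactly one: the first cell of row \<open>i\<close> lies above the last cell of row \<open>Suc i\<close>.\<close>

lemma border_strip_overlap:
  assumes bs: "border_strip lam mu"
    and "(r, j) \<in> skew_diagram lam mu" "(s, j') \<in> skew_diagram lam mu" "r \<le> i" "i < s"
  shows "lam (Suc i) = Suc (mu i)" and "(Suc i, mu i) \<in> skew_diagram lam mu"
proof -
  have "connected_cells (skew_diagram lam mu)" using bs by (simp add: border_strip_def)
  then have "\<exists>j. (i, j) \<in> skew_diagram lam mu \<and> (Suc i, j) \<in> skew_diagram lam mu"
    by (rule connected_cells_crossing[OF _ assms(2,3)]) (simp_all add: assms(4,5))
  then obtain j where j: "(i, j) \<in> skew_diagram lam mu" "(Suc i, j) \<in> skew_diagram lam mu"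
    by blast
  then show "lam (Suc i) = Suc (mu i)"
    using border_strip_overlap_le[OF bs, of i] by (auto simp: mem_skew_diagram)
  moreover have "mu (Suc i) \<le> mu i"
    using bs by (auto simp: border_strip_def skew_partition_def is_partition_def antimonoD)
  ultimately show "(Suc i, mu i) \<in> skew_diagram lam mu" by (simp add: mem_skew_diagram)
qed

lemma cell_position_right:
  assumes "skew_partition lam mu"
    and "(i, j) \<in> skew_diagram lam mu" "(i, Suc j) \<in> skew_diagram lam mu"
  shows "cell_position lam mu (i, Suc j) = Suc (cell_position lam mu (i, j))"
    and "Suc (cell_position lam mu (i, j)) \<notin> row_starts lam mu"
proof -
  let ?B = "row_offset lam mu"
  show 1: "cell_position lam mu (i, Suc j) = Suc (cell_position lam mu (i, j))"
    using assms(2) by (auto simp: cell_position_def mem_skew_diagram)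
  have bounds: "?B i < cell_position lam mu (i, Suc j)"
      "cell_position lam mu (i, Suc j) < ?B i + (lam i - mu i)"
    using cell_position_bounds[OF assms(2)] cell_position_bounds[OF assms(3)] 1 by auto
  have "?B r \<noteq> cell_position lam mu (i, Suc j)" for r
    using row_offset_le[OF assms(1), of i r] row_offset_le[OF assms(1), of r i] bounds
    by (cases i r rule: linorder_cases) auto
  then show "Suc (cell_position lam mu (i, j)) \<notin> row_starts lam mu"
    unfolding row_starts_def 1 by (metis IntD1 imageE)
qed

lemma cell_position_up:
  assumes "border_strip lam mu"
    and "(i, j) \<in> skew_diagram lam mu" "(Suc i, j) \<in> skew_diagram lam mu"
  shows "cell_position lam mu (i, j) = Suc (cell_position lam mu (Suc i, j))"
    and "Suc (cell_position lam mu (Suc i, j)) \<in> row_starts lam mu"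
proof -
  let ?B = "row_offset lam mu"
  have skew: "skew_partition lam mu" using assms(1) by (simp add: border_strip_def)
  have ov: "lam (Suc i) = Suc (mu i)"
    using border_strip_overlap(1)[OF assms, of i] by simp
  then have j: "j = mu i" using assms(2,3) by (auto simp: mem_skew_diagram)
  have pos: "cell_position lam mu (i, j) = ?B i" by (simp add: cell_position_def j)
  show 1: "cell_position lam mu (i, j) = Suc (cell_position lam mu (Suc i, j))"
    using assms(3) ov row_offset_rec[OF skew, of i]
    by (auto simp: pos j cell_position_def mem_skew_diagram)
  have eq: "Suc (cell_position lam mu (Suc i, j)) = ?B i" using 1 pos by simp
  have "?B i < card (skew_diagram lam mu)" using cell_position_less[OF skew assms(2)] pos by simp
  moreover have "0 < ?B i" using eq by simp
  ultimately show "Suc (cell_position lam mu (Suc i, j)) \<in> row_starts lam mu"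
    unfolding eq row_starts_def by simp
qed

text \<open>In the reading order, the successor of a cell is its right neighbour or, at the end of a row,
  the cell above it.\<close>

lemma consecutive_cells:
  assumes bs: "border_strip lam mu" and p: "Suc p < card (skew_diagram lam mu)"
  obtains (right) i j where "(i, j) \<in> skew_diagram lam mu" "(i, Suc j) \<in> skew_diagram lam mu"
      "cell_position lam mu (i, j) = p"
  | (up) i j where "(i, j) \<in> skew_diagram lam mu" "(Suc i, j) \<in> skew_diagram lam mu"
      "cell_position lam mu (Suc i, j) = p"
proof -
  let ?D = "skew_diagram lam mu" and ?B = "row_offset lam mu" and ?pos = "cell_position lam mu"
  have skew: "skew_partition lam mu" using bs by (simp add: border_strip_def)
  have surj: "\<exists>c\<in>?D. ?pos c = q" if "q < card ?D" for q
    using position_cell[OF skew that] by blast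
  obtain i j where ij: "(i, j) \<in> ?D" "?pos (i, j) = Suc p" using surj[OF p] by auto
  show thesis
  proof (cases "j = mu i")
    case False
    then have j: "(i, j - 1) \<in> ?D" "(i, Suc (j - 1)) \<in> ?D" "?pos (i, j - 1) = p"
      using ij by (auto simp: mem_skew_diagram cell_position_def)
    then show thesis by (rule right)
  next
    case True
    then have Bi: "?B i = Suc p" using ij by (simp add: cell_position_def)
    obtain r s where rs: "(r, s) \<in> ?D" "?pos (r, s) = p" using surj[of p] p by auto
    have "i < r"
    proof (rule ccontr)
      assume "\<not> i < r"
      then have "?B i \<le> ?B r" using row_offset_le[OF skew, of r i] by (cases "r = i") auto
      then show False using cell_position_bounds(1)[OF rs(1)] rs(2) Bi by simp
    qed
    then have "(Suc i, j) \<in> ?D"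
      using border_strip_overlap(2)[OF bs ij(1) rs(1), of i] True by simp
    moreover from this have "?pos (Suc i, j) = p"
      using cell_position_up(1)[OF bs ij(1)] ij(2) by simp
    ultimately show thesis using ij(1) by (intro up)
  qed
qed

text \<open>Rows and columns of a skew diagram are contiguous, so it suffices to compare adjacent cells.\<close>

lemma SSYT_iff_local:
  assumes skew: "skew_partition lam mu"
  shows "T \<in> SSYT k lam mu \<longleftrightarrow> T \<in> skew_diagram lam mu \<rightarrow>\<^sub>E {1..k} \<and>
     (\<forall>i j. (i, j) \<in> skew_diagram lam mu \<longrightarrow> (i, Suc j) \<in> skew_diagram lam mu \<longrightarrow>
        T (i, j) \<le> T (i, Suc j)) \<and>
     (\<forall>i j. (i, j) \<in> skew_diagram lam mu \<longrightarrow> (Suc i, j) \<in> skew_diagram lam mu \<longrightarrow>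
        T (i, j) < T (Suc i, j))" (is "?L \<longleftrightarrow> ?E \<and> ?row \<and> ?col")
proof
  assume ?L
  then show "?E \<and> ?row \<and> ?col" by (auto simp: SSYT_def)
next
  assume R: "?E \<and> ?row \<and> ?col"
  have anti: "mu i' \<le> mu i" "lam i' \<le> lam i" if "i \<le> i'" for i i'
    using skew that by (auto simp: skew_partition_def is_partition_def antimonoD)
  have row: "T (i, j) \<le> T (i, j')"
    if "(i, j) \<in> skew_diagram lam mu" "(i, j') \<in> skew_diagram lam mu" "j < j'" for i j j'
    using that(3,1,2)
  proof (induction rule: less_Suc_induct)
    case (1 j)
    then show ?case using R by simp
  next
    case (2 j j' j'')
    then have "(i, j') \<in> skew_diagram lam mu" by (auto simp: mem_skew_diagram)
    then show ?case using 2 by (meson order_trans)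
  qed
  have col: "T (i, j) < T (i', j)"
    if "(i, j) \<in> skew_diagram lam mu" "(i', j) \<in> skew_diagram lam mu" "i < i'" for i i' j
    using that(3,1,2)
  proof (induction rule: less_Suc_induct)
    case (1 i)
    then show ?case using R by simp
  next
    case (2 i i' i'')
    then have "(i', j) \<in> skew_diagram lam mu"
      using anti(1)[of i i'] anti(2)[of i' i''] by (auto simp: mem_skew_diagram)
    then show ?case using 2 by (meson less_trans)
  qed
  show ?L using R row col unfolding SSYT_def by blast
qed

definition reading_word ::
    "(nat \<Rightarrow> nat) \<Rightarrow> (nat \<Rightarrow> nat) \<Rightarrow> (nat \<times> nat \<Rightarrow> nat) \<Rightarrow> nat list" where
  "reading_word lam mu T =
     map (\<lambda>p. T (inv_into (skew_diagram lam mu) (cell_position lam mu) p) - 1)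
       [0..<card (skew_diagram lam mu)]"

lemma length_reading_word [simp]: "length (reading_word lam mu T) = card (skew_diagram lam mu)"
  by (simp add: reading_word_def)

lemma nth_reading_word:
  assumes "skew_partition lam mu" "c \<in> skew_diagram lam mu"
  shows "reading_word lam mu T ! cell_position lam mu c = T c - 1"
proof -
  have "inv_into (skew_diagram lam mu) (cell_position lam mu) (cell_position lam mu c) = c"
    using bij_betw_cell_position_card[OF assms(1)] assms(2)
    by (intro inv_into_f_f) (simp_all add: bij_betw_def)
  then show ?thesis
    using cell_position_less[OF assms] by (simp add: reading_word_def)
qed

text \<open>A vertical step of the strip is read upwards, so strict increase down the column is a descent of
  the word; a horizontal step is read to the right, so weak increase along the row is the absence
  of a descent.\<close>

lemma descent_words_iff_cells:
  assumes bs: "border_strip lam mu" and len: "length w = card (skew_diagram lam mu)"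
  defines "v \<equiv> \<lambda>c. w ! cell_position lam mu c"
  shows "w \<in> descent_words k (card (skew_diagram lam mu)) (row_starts lam mu) \<longleftrightarrow>
     (\<forall>c\<in>skew_diagram lam mu. v c < k) \<and>
     (\<forall>i j. (i, j) \<in> skew_diagram lam mu \<longrightarrow> (i, Suc j) \<in> skew_diagram lam mu \<longrightarrow>
        v (i, j) \<le> v (i, Suc j)) \<and>
     (\<forall>i j. (i, j) \<in> skew_diagram lam mu \<longrightarrow> (Suc i, j) \<in> skew_diagram lam mu \<longrightarrow>
        v (i, j) < v (Suc i, j))" (is "?L \<longleftrightarrow> ?E \<and> ?row \<and> ?col")
proof -
  let ?D = "skew_diagram lam mu"
  have skew: "skew_partition lam mu" using bs by (simp add: border_strip_def)
  have letters: "set w \<subseteq> {..<k} \<longleftrightarrow> ?E"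
  proof -
    have "set w = v ` ?D"
    proof (intro equalityI subsetI)
      fix x assume "x \<in> set w"
      then obtain p where p: "p < card ?D" "x = w ! p" by (auto simp: in_set_conv_nth len)
      then show "x \<in> v ` ?D" using position_cell[OF skew p(1)] by (auto simp: v_def)
    next
      fix x assume "x \<in> v ` ?D"
      then show "x \<in> set w" using cell_position_less[OF skew] len by (auto simp: v_def)
    qed
    then show ?thesis by auto
  qed
  have "(\<forall>p. Suc p < card ?D \<longrightarrow> (w ! Suc p < w ! p \<longleftrightarrow> Suc p \<in> row_starts lam mu)) \<longleftrightarrow> ?row \<and> ?col"
    (is "?des \<longleftrightarrow> _")
  proof
    assume des: ?des
    show "?row \<and> ?col"
    proof (intro conjI allI impI)
      fix i j assume D: "(i, j) \<in> ?D" "(i, Suc j) \<in> ?D"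
      with des show "v (i, j) \<le> v (i, Suc j)"
        using cell_position_right[OF skew D] cell_position_less[OF skew D(2)]
        by (simp add: v_def not_less[symmetric])
    next
      fix i j assume D: "(i, j) \<in> ?D" "(Suc i, j) \<in> ?D"
      with des show "v (i, j) < v (Suc i, j)"
        using cell_position_up[OF bs D] cell_position_less[OF skew D(1)]
        by (simp add: v_def)
    qed
  next
    assume rc: "?row \<and> ?col"
    show ?des
    proof (intro allI impI)
      fix p assume p: "Suc p < card ?D"
      from bs p show "w ! Suc p < w ! p \<longleftrightarrow> Suc p \<in> row_starts lam mu"
      proof (cases rule: consecutive_cells)
        case (right i j)
        then have "v (i, j) \<le> v (i, Suc j)" using rc by blast
        then show ?thesis
          using cell_position_right[OF skew right(1,2)] right(3) by (simp add: v_def not_less)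
      next
        case (up i j)
        then have "v (i, j) < v (Suc i, j)" using rc by blast
        then show ?thesis
          using cell_position_up[OF bs up(1,2)] up(3) by (simp add: v_def)
      qed
    qed
  qed
  then show ?thesis using len letters by (simp add: descent_words_def)
qed

lemma bij_betw_reading_word:
  assumes bs: "border_strip lam mu"
  shows "bij_betw (reading_word lam mu) (SSYT k lam mu)
           (descent_words k (card (skew_diagram lam mu)) (row_starts lam mu))"
proof -
  let ?D = "skew_diagram lam mu" and ?pos = "cell_position lam mu"
  let ?W = "descent_words k (card ?D) (row_starts lam mu)"
  have skew: "skew_partition lam mu" using bs by (simp add: border_strip_def)
  define fill where "fill w = (\<lambda>c\<in>?D. Suc (w ! ?pos c))" for w :: "nat list"
  note nth = nth_reading_word[OF skew]
  have pos: "T c \<in> {1..k}" if "T \<in> SSYT k lam mu" "c \<in> ?D" for T c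
    using that by (auto simp: SSYT_def PiE_iff)
  have fill_word: "fill (reading_word lam mu T) = T" if T: "T \<in> SSYT k lam mu" for T
  proof
    fix c
    show "fill (reading_word lam mu T) c = T c"
    proof (cases "c \<in> ?D")
      case True
      then show ?thesis using nth[OF True] pos[OF T True] by (simp add: fill_def)
    next
      case False
      have "T \<in> ?D \<rightarrow>\<^sub>E {1..k}" using T by (simp add: SSYT_def)
      from PiE_arb[OF this False] show ?thesis using False by (simp add: fill_def)
    qed
  qed
  have word_fill: "reading_word lam mu (fill w) = w" if w: "w \<in> ?W" for w
  proof (rule nth_equalityI)
    show len: "length (reading_word lam mu (fill w)) = length w"
      using w by (simp add: descent_words_def)
    fix p assume "p < length (reading_word lam mu (fill w))"
    then obtain c where "c \<in> ?D" "p = ?pos c" using position_cell[OF skew] by auto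
    then show "reading_word lam mu (fill w) ! p = w ! p" by (simp add: nth fill_def)
  qed
  have "reading_word lam mu T \<in> ?W" if T: "T \<in> SSYT k lam mu" for T
  proof -
    have T1: "1 \<le> T c \<and> T c \<le> k" if "c \<in> ?D" for c using pos[OF T that] by simp
    have row: "T (i, j) \<le> T (i, Suc j)" if "(i, j) \<in> ?D" "(i, Suc j) \<in> ?D" for i j
      using T that unfolding SSYT_iff_local[OF skew] by blast
    have col: "T (i, j) < T (Suc i, j)" if "(i, j) \<in> ?D" "(Suc i, j) \<in> ?D" for i j
      using T that unfolding SSYT_iff_local[OF skew] by blast
    show ?thesis
      unfolding descent_words_iff_cells[OF bs length_reading_word]
    proof (intro conjI allI ballI impI)
      fix c assume c: "c \<in> ?D"
      show "reading_word lam mu T ! ?pos c < k" unfolding nth[OF c] using T1[OF c] by linarith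
    next
      fix i j assume D: "(i, j) \<in> ?D" "(i, Suc j) \<in> ?D"
      show "reading_word lam mu T ! ?pos (i, j) \<le> reading_word lam mu T ! ?pos (i, Suc j)"
        unfolding nth[OF D(1)] nth[OF D(2)] using row[OF D] by linarith
    next
      fix i j assume D: "(i, j) \<in> ?D" "(Suc i, j) \<in> ?D"
      show "reading_word lam mu T ! ?pos (i, j) < reading_word lam mu T ! ?pos (Suc i, j)"
        unfolding nth[OF D(1)] nth[OF D(2)] using col[OF D] T1[OF D(1)] by linarith
    qed
  qed
  moreover have "fill w \<in> SSYT k lam mu" if w: "w \<in> ?W" for w
  proof -
    have "length w = card ?D" using w by (simp add: descent_words_def)
    note w' = w[unfolded descent_words_iff_cells[OF bs this]]
    show ?thesis
      unfolding SSYT_iff_local[OF skew]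
    proof (intro conjI allI impI PiE_I)
      fix c assume "c \<in> ?D"
      then show "fill w c \<in> {1..k}" using w' by (simp add: fill_def Suc_le_eq)
    qed (use w' in \<open>simp_all add: fill_def\<close>)
  qed
  ultimately show ?thesis
    using fill_word word_fill by (intro bij_betw_byWitness[where f' = fill]) auto
qed

lemma sum_list_reading_word:
  assumes skew: "skew_partition lam mu"
  shows "sum_list (reading_word lam mu T) = (\<Sum>c\<in>skew_diagram lam mu. T c - 1)"
proof -
  let ?D = "skew_diagram lam mu" and ?pos = "cell_position lam mu"
  have "bij_betw ?pos ?D {..<card ?D}"
    using bij_betw_cell_position[OF skew] by (simp add: card_skew_diagram[OF skew])
  then have "(\<Sum>c\<in>?D. reading_word lam mu T ! ?pos c) = (\<Sum>p<card ?D. reading_word lam mu T ! p)"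
    by (rule sum.reindex_bij_betw)
  then show ?thesis
    by (simp add: nth_reading_word[OF skew] sum_list_sum_nth atLeast0LessThan)
qed

lemma finite_SSYT: "border_strip lam mu \<Longrightarrow> finite (SSYT k lam mu)"
  using bij_betw_finite[OF bij_betw_reading_word, of lam mu k] by simp

lemma principal_specialization_eq_sum:
  assumes bs: "border_strip lam mu"
  shows "principal_specialization k lam mu =
    (\<Sum>T\<in>SSYT k lam mu. Polynomial.monom 1 (sum_list (reading_word lam mu T)))"
proof -
  let ?D = "skew_diagram lam mu"
  have skew: "skew_partition lam mu" using bs by (simp add: border_strip_def)
  show ?thesis unfolding principal_specialization_def skew_schur_def
  proof (rule sum.cong [OF refl])
    fix T assume T: "T \<in> SSYT k lam mu"
    have "(\<Prod>i = 1..k. (([:0, 1:] :: int poly) ^ (i - 1)) ^ card {c \<in> ?D. T c = i}) =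
        (\<Prod>i = 1..k. \<Prod>c | c \<in> ?D \<and> T c = i. ([:0, 1:] :: int poly) ^ (T c - 1))"
      by (intro prod.cong refl) simp
    also have "\<dots> = (\<Prod>c\<in>?D. [:0, 1:] ^ (T c - 1))"
      using T finite_skew_diagram[OF skew] by (intro prod.group) (auto simp: SSYT_def)
    also have "\<dots> = [:0, 1:] ^ (\<Sum>c\<in>?D. T c - 1)" by (simp add: power_sum)
    also have "\<dots> = Polynomial.monom 1 (sum_list (reading_word lam mu T))"
      by (simp add: sum_list_reading_word[OF skew] monom_altdef)
    finally show "(\<Prod>i = 1..k. (([:0, 1:] :: int poly) ^ (i - 1)) ^ card {c \<in> ?D. T c = i}) =
       Polynomial.monom 1 (sum_list (reading_word lam mu T))" .
  qed
qed

section \<open>Cyclic sieving for border strips\<close>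

theorem theorem1p2:
  fixes k m :: nat and lam mu :: "nat \<Rightarrow> nat" and C :: "'c monoid"
  assumes "0 < k" and "0 < m"
    and "border_strip lam mu"
    and "\<forall>i. m dvd lam i - mu i"
    and "group C" and "cyclic_group C" and "Coset.order C = m"
  shows "\<exists>act. group_action C (SSYT k lam mu) act \<and>
           cyclic_sieving (SSYT k lam mu) C act (principal_specialization k lam mu)"
proof -
  let ?D = "skew_diagram lam mu" and ?S = "row_starts lam mu"
  define rw where "rw = reading_word lam mu"
  have skew: "skew_partition lam mu" using assms(3) by (simp add: border_strip_def)
  have bij: "bij_betw rw (SSYT k lam mu) (descent_words k (card ?D) ?S)"
    unfolding rw_def by (rule bij_betw_reading_word [OF assms(3)])
  have evals: "(\<Sum>T\<in>SSYT k lam mu. z ^ sum_list (rw T)) =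
      of_nat (card {T \<in> SSYT k lam mu. d dvd dilation_index m (rw T)})"
    if d: "d dvd m" and z: "primitive_root_of_unity d z" for d z
  proof -
    have offset: "d dvd row_offset lam mu i" for i
      using dvd_row_offset [OF assms(4)] d dvd_trans by blast
    have "d dvd card ?D"
      using offset [of 0] d assms(4) dvd_trans [of d m "lam 0 - mu 0"]
      by (simp add: card_skew_diagram [OF skew])
    moreover have "?S \<subseteq> {0<..<card ?D}" by (simp add: row_starts_def)
    moreover have "d dvd r" if "r \<in> ?S" for r using that offset by (auto simp: row_starts_def)
    ultimately have words: "(\<Sum>w\<in>descent_words k (card ?D) ?S. z ^ sum_list w) =
        of_nat (card {w \<in> descent_words k (card ?D) ?S. dilated d w})"
      by (rule sum_root_of_unity_descent_words [OF z])
    have inj: "inj_on rw {T \<in> SSYT k lam mu. dilated d (rw T)}"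
      using bij by (auto simp: bij_betw_def intro: inj_on_subset)
    have img: "rw ` {T \<in> SSYT k lam mu. dilated d (rw T)} =
        {w \<in> descent_words k (card ?D) ?S. dilated d w}"
      unfolding bij_betw_imp_surj_on [OF bij, symmetric] by auto
    have "card {T \<in> SSYT k lam mu. dilated d (rw T)} =
        card {w \<in> descent_words k (card ?D) ?S. dilated d w}"
      by (simp only: img [symmetric] card_image [OF inj])
    moreover have "(\<Sum>T\<in>SSYT k lam mu. z ^ sum_list (rw T)) =
        (\<Sum>w\<in>descent_words k (card ?D) ?S. z ^ sum_list w)"
      by (rule sum.reindex_bij_betw [OF bij])
    ultimately show ?thesis using words d by (simp add: dvd_dilation_index_iff)
  qed
  have index: "dilation_index m (rw T) dvd m" for T
    using dvd_dilation_index_iff [of "dilation_index m (rw T)" m "rw T"] by simp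
  show ?thesis
    unfolding principal_specialization_eq_sum [OF assms(3)] rw_def [symmetric]
    by (rule ex_cyclic_sieving [where e = "\<lambda>T. dilation_index m (rw T)",
          OF assms(5-7,2) finite_SSYT [OF assms(3)] index evals])
qed

end
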